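(* Let $\theta\colon\mathbb F(A)\curvearrowright\Omega$ be a convex subshift of finite type over a finite alphabet $A$. Then there is a finite bipartite separated graph $(E,C)$ such that the canonical partial action $\theta^{(E,C)}$ and $\theta$ are Kakutani equivalent.
   Context: Convex subshifts: $\mathbb F=\mathbb F(A)$; $\mathcal C(A)$ is the set of $\xi\subseteq\mathbb F$ with $1\in\xi$ that are right-convex (if a reduced word $a_m^{\varepsilon_m}\cdots a_1^{\varepsilon_1}$ lies in $\xi$ then so does $a_k^{\varepsilon_k}\cdots a_1^{\varepsilon_1}$ for $k<m$), with topology from $\{0,1\}^{\mathbb F}$; the full convex shift has domains $\mathcal C_\alpha=\{\xi:\alpha^{-1}\in\xi\}$ and $\alpha.\xi=\xi\alpha^{-1}$; a convex subshift is its restriction to a closed invariant $\Omega$. With $\xi^n=\{\alpha\in\xi:|\alpha|\le n\}$, an $n$-ball is an element of $\mathcal C$ all of whose words have length $\le n$ (with radius $n$), $\xi\not\equiv B$ means $(\alpha.\xi)^n\ne B$ for all $\alpha\in\xi$, and $\Omega$ is of finite type if $\Omega=\{\xi\in\mathcal C:\xi\not\equiv B\ \forall B\in\mathcal F\}$ for a finite set $\mathcal F$ of balls. Separated graphs: $(E,C)$ with $E=(E^0,E^1,r,s)$ a directed graph and $C=\bigsqcup_vC_v$, $C_v$ a partition of $r^{-1}(v)$ into non-empty sets; finite bipartite means $E$ finite and $E^0=E^{0,0}\sqcup E^{0,1}$ with $s(E^1)=E^{0,1}$, $r(E^1)=E^{0,0}$. With $\mathbb F(E^1)$ the free group on $E^1$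 and $\xi_\alpha=\{\sigma\in E^1\sqcup(E^1)^{-1}:\sigma\alpha\in\xi\}$, $\Omega(E,C)$ is the set of right-convex $\xi\subseteq\mathbb F(E^1)$ with $1\in\xi$ such that for each $\alpha\in\xi$ either $\xi_\alpha=s^{-1}(v)$ for some $v\in E^{0,1}$ or $\xi_\alpha=\{e_X^{-1}:X\in C_v\}$ for some $v\in E^{0,0}$ and $e_X\in X$; $\theta^{(E,C)}$ is the partial action with domains $\{\xi:\alpha^{-1}\in\xi\}$ and $\theta_\alpha(\xi)=\xi\alpha^{-1}$. Partial actions: for $\theta\colon G\curvearrowright\Omega$, $\Omega_g$ is the domain of $\theta_{g^{-1}}$. For open $U\subseteq\Omega$, the restriction $\theta|_U$ has domains $U_g=\theta_g(U\cap\Omega_{g^{-1}})\cap U$; $U$ is $G$-full if $\Omega=\{g.x:g\in G,x\in U\cap\Omega_{g^{-1}}\}$. Dynamical equivalence $\approx$ of partial actions means isomorphism of their transformation groupoids (equivalently: a homeomorphism $\varphi$ of the spaces and continuous cocycles $a,b$ intertwining the actions, mutually inverse along $\varphi$). Two partial actions $\theta\colon G\curvearrowright\Omega$, $\gamma\colon H\curvearrowright\Omega'$ are Kakutani equivalent if there are clopen $K\subseteq\Omega$, $K'\subseteq\Omega'$, respectively $G$-full and $H$-full, with $\theta|_K\approx\gamma|_{K'}$. *)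

theory Defs
  imports "HOL-Analysis.Analysis"
begin

text \<open>A word is a list of letters with exponents; (a, True) is a and (a, False) is a inverse.
  The head of the list is the LEFTMOST letter, so the word a_m^e_m ... a_1^e_1 is the list
  [(a_m,e_m), ..., (a_1,e_1)]; the identity 1 is the empty list.\<close>

type_synonym 'a word = "('a \<times> bool) list"

definition letinv :: "'a \<times> bool \<Rightarrow> 'a \<times> bool" where
  "letinv x = (fst x, \<not> snd x)"

fun reduced :: "'a word \<Rightarrow> bool" where
  "reduced [] = True"
| "reduced [x] = True"
| "reduced (x # y # w) = (y \<noteq> letinv x \<and> reduced (y # w))"

definition FG :: "'a set \<Rightarrow> 'a word set" where
  "FG A = {w. reduced w \<and> fst ` set w \<subseteq> A}"

definition cons_red :: "'a \<times> bool \<Rightarrow> 'a word \<Rightarrow> 'a word" where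
  "cons_red x w = (case w of [] \<Rightarrow> [x] | y # w' \<Rightarrow> (if y = letinv x then w' else x # w))"

definition wmult :: "'a word \<Rightarrow> 'a word \<Rightarrow> 'a word" where
  "wmult u v = foldr cons_red u v"

definition winv :: "'a word \<Rightarrow> 'a word" where
  "winv u = rev (map letinv u)"

definition right_convex :: "'a word set \<Rightarrow> bool" where
  "right_convex \<xi> \<longleftrightarrow> (\<forall>w\<in>\<xi>. \<forall>k. drop k w \<in> \<xi>)"

definition Conv :: "'a set \<Rightarrow> 'a word set set" where
  "Conv A = {\<xi>. \<xi> \<subseteq> FG A \<and> [] \<in> \<xi> \<and> right_convex \<xi>}"

text \<open>Product topology of {0,1}^(words), generated by the cylinder sets.\<close>
definition set_top :: "'a word set topology" where
  "set_top = topology_generated_by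
     ({{\<xi>. w \<in> \<xi>} | w. True} \<union> {{\<xi>. w \<notin> \<xi>} | w. True})"

text \<open>The (full) convex shift: theta_alpha is defined on {xi. alpha \<in> xi} (= C_{alpha^-1})
  and maps xi to xi alpha^-1.\<close>
definition shift_dom :: "'a word set set \<Rightarrow> 'a word \<Rightarrow> 'a word set set" where
  "shift_dom \<Omega> \<alpha> = {\<xi> \<in> \<Omega>. \<alpha> \<in> \<xi>}"

definition shift_act :: "'a word \<Rightarrow> 'a word set \<Rightarrow> 'a word set" where
  "shift_act \<alpha> \<xi> = (\<lambda>w. wmult w (winv \<alpha>)) ` \<xi>"

definition convex_subshift :: "'a set \<Rightarrow> 'a word set set \<Rightarrow> bool" where
  "convex_subshift A \<Omega> \<longleftrightarrow> \<Omega> \<subseteq> Conv A \<and> closedin (subtopology set_top (Conv A)) \<Omega>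
     \<and> (\<forall>\<alpha>\<in>FG A. \<forall>\<xi>\<in>\<Omega>. \<alpha> \<in> \<xi> \<longrightarrow> shift_act \<alpha> \<xi> \<in> \<Omega>)"

definition trunc :: "nat \<Rightarrow> 'a word set \<Rightarrow> 'a word set" where
  "trunc n \<xi> = {w \<in> \<xi>. length w \<le> n}"

definition is_ball :: "'a set \<Rightarrow> 'a word set \<times> nat \<Rightarrow> bool" where
  "is_ball A Bn \<longleftrightarrow> fst Bn \<in> Conv A \<and> (\<forall>w\<in>fst Bn. length w \<le> snd Bn)"

definition avoids :: "'a word set \<Rightarrow> 'a word set \<times> nat \<Rightarrow> bool" where
  "avoids \<xi> Bn \<longleftrightarrow> (\<forall>\<alpha>\<in>\<xi>. trunc (snd Bn) (shift_act \<alpha> \<xi>) \<noteq> fst Bn)"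

definition of_finite_type :: "'a set \<Rightarrow> 'a word set set \<Rightarrow> bool" where
  "of_finite_type A \<Omega> \<longleftrightarrow> (\<exists>\<F>. finite \<F> \<and> (\<forall>Bn\<in>\<F>. is_ball A Bn) \<and>
      \<Omega> = {\<xi> \<in> Conv A. \<forall>Bn\<in>\<F>. avoids \<xi> Bn})"

definition finite_bipartite_sep_graph ::
  "'v set \<Rightarrow> 'v set \<Rightarrow> 'v set \<Rightarrow> 'e set \<Rightarrow> ('e \<Rightarrow> 'v) \<Rightarrow> ('e \<Rightarrow> 'v) \<Rightarrow> ('v \<Rightarrow> 'e set set) \<Rightarrow> bool"
  where
  "finite_bipartite_sep_graph E0 E00 E01 E1 r s C \<longleftrightarrow>
     finite E0 \<and> finite E1 \<and>
     E0 = E00 \<union> E01 \<and> E00 \<inter> E01 = {} \<and>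
     s ` E1 = E01 \<and> r ` E1 = E00 \<and>
     (\<forall>v\<in>E0. (\<forall>X\<in>C v. X \<noteq> {}) \<and> \<Union>(C v) = {e\<in>E1. r e = v} \<and>
        (\<forall>X\<in>C v. \<forall>Y\<in>C v. X \<noteq> Y \<longrightarrow> X \<inter> Y = {})) \<and>
     (\<forall>v. v \<notin> E0 \<longrightarrow> C v = {})"

definition local_config :: "'e set \<Rightarrow> 'e word set \<Rightarrow> 'e word \<Rightarrow> ('e \<times> bool) set" where
  "local_config E1 \<xi> \<alpha> = {\<sigma>. fst \<sigma> \<in> E1 \<and> wmult [\<sigma>] \<alpha> \<in> \<xi>}"

definition OmegaEC ::
  "'v set \<Rightarrow> 'v set \<Rightarrow> 'e set \<Rightarrow> ('e \<Rightarrow> 'v) \<Rightarrow> ('e \<Rightarrow> 'v) \<Rightarrow> ('v \<Rightarrow> 'e set set) \<Rightarrow> 'e word set set"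
  where
  "OmegaEC E00 E01 E1 r s C = {\<xi>. \<xi> \<subseteq> FG E1 \<and> [] \<in> \<xi> \<and> right_convex \<xi> \<and>
     (\<forall>\<alpha>\<in>\<xi>.
        (\<exists>v\<in>E01. local_config E1 \<xi> \<alpha> = {(e, True) | e. e \<in> E1 \<and> s e = v}) \<or>
        (\<exists>v\<in>E00. \<exists>c. (\<forall>X\<in>C v. c X \<in> X) \<and>
            local_config E1 \<xi> \<alpha> = {(c X, False) | X. X \<in> C v}))}"

text \<open>A partial action of the free group with carrier G on the space with topology X is
  given by D g (the domain of theta_g) and act g. The transformation groupoid of the
  restriction to U has arrows (g,x) with x \<in> U in the domain of theta_g and theta_g x \<in> U,
  topology from G (discrete) times X, and (g, theta_h x)(h, x) = (gh, x).\<close>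

definition ta_arrows :: "'a word set \<Rightarrow> ('a word \<Rightarrow> 'x set) \<Rightarrow> ('a word \<Rightarrow> 'x \<Rightarrow> 'x) \<Rightarrow> 'x set
    \<Rightarrow> ('a word \<times> 'x) set" where
  "ta_arrows G D act U = {(g, x). g \<in> G \<and> x \<in> U \<and> x \<in> D g \<and> act g x \<in> U}"

definition ta_top :: "'a word set \<Rightarrow> 'x topology \<Rightarrow> ('a word \<Rightarrow> 'x set) \<Rightarrow> ('a word \<Rightarrow> 'x \<Rightarrow> 'x)
    \<Rightarrow> 'x set \<Rightarrow> ('a word \<times> 'x) topology" where
  "ta_top G X D act U = subtopology (prod_topology (discrete_topology G) X) (ta_arrows G D act U)"

definition ta_composable :: "('a word \<Rightarrow> 'x \<Rightarrow> 'x) \<Rightarrow> 'a word \<times> 'x \<Rightarrow> 'a word \<times> 'x \<Rightarrow> bool" where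
  "ta_composable act p q \<longleftrightarrow> snd p = act (fst q) (snd q)"

definition ta_prod :: "'a word \<times> 'x \<Rightarrow> 'a word \<times> 'x \<Rightarrow> 'a word \<times> 'x" where
  "ta_prod p q = (wmult (fst p) (fst q), snd q)"

text \<open>Dynamical equivalence of the restrictions: isomorphism of topological groupoids.\<close>
definition dyn_equiv ::
  "'a word set \<Rightarrow> 'x topology \<Rightarrow> ('a word \<Rightarrow> 'x set) \<Rightarrow> ('a word \<Rightarrow> 'x \<Rightarrow> 'x) \<Rightarrow> 'x set \<Rightarrow>
   'b word set \<Rightarrow> 'y topology \<Rightarrow> ('b word \<Rightarrow> 'y set) \<Rightarrow> ('b word \<Rightarrow> 'y \<Rightarrow> 'y) \<Rightarrow> 'y set \<Rightarrow> bool" where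
  "dyn_equiv G X D act U H Y D' act' V \<longleftrightarrow>
    (\<exists>\<Phi>. homeomorphic_map (ta_top G X D act U) (ta_top H Y D' act' V) \<Phi> \<and>
      (\<forall>p\<in>ta_arrows G D act U. \<forall>q\<in>ta_arrows G D act U.
         (ta_composable act p q \<longleftrightarrow> ta_composable act' (\<Phi> p) (\<Phi> q)) \<and>
         (ta_composable act p q \<longrightarrow> \<Phi> (ta_prod p q) = ta_prod (\<Phi> p) (\<Phi> q))))"

definition is_full :: "'a word set \<Rightarrow> 'x set \<Rightarrow> ('a word \<Rightarrow> 'x set) \<Rightarrow> ('a word \<Rightarrow> 'x \<Rightarrow> 'x) \<Rightarrow> 'x set \<Rightarrow> bool" where
  "is_full G \<Omega> D act U \<longleftrightarrow> \<Omega> = {act g x | g x. g \<in> G \<and> x \<in> U \<and> x \<in> D g}"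

definition kakutani_equiv ::
  "'a word set \<Rightarrow> 'x topology \<Rightarrow> ('a word \<Rightarrow> 'x set) \<Rightarrow> ('a word \<Rightarrow> 'x \<Rightarrow> 'x) \<Rightarrow>
   'b word set \<Rightarrow> 'y topology \<Rightarrow> ('b word \<Rightarrow> 'y set) \<Rightarrow> ('b word \<Rightarrow> 'y \<Rightarrow> 'y) \<Rightarrow> bool" where
  "kakutani_equiv G X D act H Y D' act' \<longleftrightarrow>
    (\<exists>K K'. closedin X K \<and> openin X K \<and> closedin Y K' \<and> openin Y K' \<and>
       is_full G (topspace X) D act K \<and> is_full H (topspace Y) D' act' K' \<and>
       dyn_equiv G X D act K H Y D' act' K')"

definition shift_kakutani_equiv :: "'a set \<Rightarrow> 'a word set set \<Rightarrow> 'b set \<Rightarrow> 'b word set set \<Rightarrow> bool" where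
  "shift_kakutani_equiv A \<Omega> B \<Omega>' \<longleftrightarrow>
     kakutani_equiv (FG A) (subtopology set_top \<Omega>) (shift_dom \<Omega>) shift_act
                    (FG B) (subtopology set_top \<Omega>') (shift_dom \<Omega>') shift_act"

end

theory Submission
  imports Defs
begin

text \<open>Choose a radius \<open>N \<ge> 1\<close> at least that of every forbidden ball. Then \<open>\<xi> \<in> \<Omega>\<close> means that the \<open>N\<close>-ball
  around every point of \<open>\<xi>\<close> is allowed, i.e. occurs in \<open>\<Omega>\<close>. Build a bipartite graph with the allowed
  balls on the source side: a ball \<open>B\<close> emits one edge for each letter \<open>\<sigma> \<in> B\<close>, and its range is the
  letter together with the part of \<open>B\<close> that is also seen from the other end of \<open>\<sigma>\<close>. The two sets of the
  separation at such a range are the two orientations of the letter, so a configuration of the graph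
  chooses at each letter a neighbouring ball that agrees on the overlap. These choices are independent
  because Cayley graphs of free groups are trees. The configurations with a ball at 1 thus correspond
  to \<open>\<Omega>\<close>: a homomorphism \<open>F(E1) \<rightarrow> F(A)\<close> projects them, and the inverse lifts each letter to a path of
  length two. As the cocycle is a homomorphism, this is an isomorphism of groupoids. It is a
  homeomorphism because both directions depend only on finite balls.\<close>

section \<open>Reduced words\<close>

text \<open>In a separated graph the choices from the sets \<open>X\<close> at a range vertex are
  free, so a range has to record exactly what makes neighbouring balls compatible: every edge of one
  orientation must fit every edge of the other. Balls are required to occur in \<Omega> because each
  edge labelled by a letter then has a partner of the opposite orientation, and no set of the
  separation is missing. The radius is at least 1 so that a ball shows which letters leave its
  centre. In the converse direction a configuration is known only locally; that the balls it carries
  are the balls of one convex set is where the agreement on overlaps is used. Configurations whose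
  vertex at 1 is a range have no counterpart in \<Omega>. They are discarded by passing to a clopen
  set, which is full because one inverse edge leads from each of them to a ball.\<close>

lemma letinv_letinv [simp]: "letinv (letinv x) = x"
  by (simp add: letinv_def)

lemma letinv_neq [simp]: "letinv x \<noteq> x" "x \<noteq> letinv x"
  by (auto simp: letinv_def prod_eq_iff)

lemma letinv_Pair [simp]: "letinv (a, b) = (a, \<not> b)"
  by (simp add: letinv_def)

lemma fst_letinv [simp]: "fst (letinv x) = fst x"
  by (simp add: letinv_def)

lemma reduced_Cons: "reduced (x # w) \<longleftrightarrow> reduced w \<and> (w = [] \<or> hd w \<noteq> letinv x)"
  by (cases w) auto

lemma reduced_append: "reduced (u @ v) \<Longrightarrow> reduced u \<and> reduced v"
  by (induction u) (auto simp: reduced_Cons hd_append split: if_splits)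

lemma reduced_cons_red: "reduced w \<Longrightarrow> reduced (cons_red x w)"
  by (cases w) (auto simp: cons_red_def reduced_Cons)

lemma cons_red_reduced: "reduced (x # w) \<Longrightarrow> cons_red x w = x # w"
  by (cases w) (auto simp: cons_red_def)

lemma cons_red_cancel_list [simp]: "cons_red x (letinv x # w) = w"
  by (simp add: cons_red_def)

lemma cons_red_not_reduced:
  "reduced w \<Longrightarrow> \<not> reduced (x # w) \<Longrightarrow> w = letinv x # cons_red x w"
  by (cases w) (auto simp: cons_red_def reduced_Cons)

text \<open>On reduced words, multiplying by a letter and by its inverse are mutually inverse maps.
  This is van der Waerden's device: multiplication is a composition of such maps, which yields the
  group laws without a confluence argument.\<close>

lemma cons_red_letinv: "reduced w \<Longrightarrow> cons_red (letinv x) (cons_red x w) = w"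
  by (cases w; cases "tl w") (auto simp: cons_red_def)

lemma cons_red_letinv': "reduced w \<Longrightarrow> cons_red x (cons_red (letinv x) w) = w"
  using cons_red_letinv[of w "letinv x"] by simp

lemma set_cons_red: "set (cons_red x w) \<subseteq> insert x (set w)"
  by (cases w) (auto simp: cons_red_def)

lemma length_cons_red: "length (cons_red x w) \<le> Suc (length w)"
  by (cases w) (auto simp: cons_red_def)

lemma even_length_cons_red: "even (length (cons_red x w)) \<longleftrightarrow> odd (length w)"
  by (cases w) (auto simp: cons_red_def)

section \<open>The group law on reduced words\<close>

lemma wmult_Nil [simp]: "wmult [] v = v"
  by (simp add: wmult_def)

lemma wmult_Cons [simp]: "wmult (x # u) v = cons_red x (wmult u v)"
  by (simp add: wmult_def)

lemma wmult_append: "wmult (u @ v) w = wmult u (wmult v w)"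
  by (simp add: wmult_def)

lemma reduced_wmult: "reduced v \<Longrightarrow> reduced (wmult u v)"
  by (induction u) (auto simp: reduced_cons_red)

lemma wmult_reduced_append: "reduced (u @ v) \<Longrightarrow> wmult u v = u @ v"
  by (induction u) (auto simp: reduced_Cons cons_red_reduced)

lemma wmult_Nil_right: "reduced u \<Longrightarrow> wmult u [] = u"
  using wmult_reduced_append[of u "[]"] by simp

text \<open>The core of associativity: a letter that cancels the head of \<open>u\<close> acts on
  \<open>v\<close> by undoing the map of that head.\<close>

lemma wmult_cons_red: "reduced v \<Longrightarrow> wmult (cons_red x u) v = cons_red x (wmult u v)"
  by (cases u) (auto simp: cons_red_def[of x "_ # _"] cons_red_def[of x "[]"] cons_red_letinv' reduced_wmult)

lemma wmult_assoc: "reduced w \<Longrightarrow> wmult (wmult u v) w = wmult u (wmult v w)"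
  by (induction u) (auto simp: wmult_cons_red)

lemma winv_Nil [simp]: "winv [] = []"
  by (simp add: winv_def)

lemma winv_Cons: "winv (x # u) = winv u @ [letinv x]"
  by (simp add: winv_def)

lemma winv_singleton [simp]: "winv [x] = [letinv x]"
  by (simp add: winv_def)

lemma winv_winv [simp]: "winv (winv u) = u"
  by (simp add: winv_def rev_map comp_def)

lemma length_winv [simp]: "length (winv u) = length u"
  by (simp add: winv_def)

lemma fst_set_winv: "fst ` set (winv u) = fst ` set u"
  by (auto simp: winv_def image_image)

lemma reduced_snoc: "reduced (w @ [y, x]) \<longleftrightarrow> reduced (w @ [y]) \<and> x \<noteq> letinv y"
  by (induction w rule: reduced.induct) auto

lemma reduced_winv: "reduced u \<Longrightarrow> reduced (winv u)"
proof (induction u rule: reduced.induct)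
  case (3 x y w)
  then show ?case
    by (simp add: winv_Cons reduced_snoc) (metis letinv_letinv)
qed auto

lemma wmult_winv_cancel: "reduced v \<Longrightarrow> wmult (winv u) (wmult u v) = v"
  by (induction u) (auto simp: winv_Cons wmult_append cons_red_letinv reduced_wmult)

lemma wmult_winv_left: "reduced u \<Longrightarrow> wmult (winv u) u = []"
  using wmult_winv_cancel[of "[]" u] by (simp add: wmult_Nil_right)

lemma wmult_winv_right: "reduced u \<Longrightarrow> wmult u (winv u) = []"
  using wmult_winv_left[of "winv u"] by (simp add: reduced_winv)

lemma wmult_cancel_right: "reduced u \<Longrightarrow> reduced v \<Longrightarrow> wmult (wmult v u) (winv u) = v"
  by (simp add: wmult_assoc reduced_winv wmult_winv_right wmult_Nil_right)

lemma wmult_cancel_right': "reduced u \<Longrightarrow> reduced v \<Longrightarrow> wmult (wmult v (winv u)) u = v"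
  using wmult_cancel_right[of "winv u" v] by (simp add: reduced_winv)

lemma length_wmult: "length (wmult u v) \<le> length u + length v"
  by (induction u) (auto intro: order_trans[OF length_cons_red])

lemma even_length_wmult:
  "even (length (wmult u v)) \<longleftrightarrow> (even (length u) \<longleftrightarrow> even (length v))"
  by (induction u) (auto simp: even_length_cons_red)

lemma FG_reduced: "w \<in> FG A \<Longrightarrow> reduced w"
  by (simp add: FG_def)

lemma Nil_FG [simp]: "[] \<in> FG A"
  by (simp add: FG_def)

lemma FG_Cons: "x # w \<in> FG A \<longleftrightarrow> reduced (x # w) \<and> fst x \<in> A \<and> w \<in> FG A"
  by (auto simp: FG_def reduced_Cons)

lemma FG_cons_red: "w \<in> FG A \<Longrightarrow> fst x \<in> A \<Longrightarrow> cons_red x w \<in> FG A"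
  using set_cons_red[of x w] by (auto simp: FG_def reduced_cons_red)

lemma FG_wmult: "u \<in> FG A \<Longrightarrow> v \<in> FG A \<Longrightarrow> wmult u v \<in> FG A"
  by (induction u) (auto simp: FG_Cons FG_cons_red)

lemma FG_winv: "u \<in> FG A \<Longrightarrow> winv u \<in> FG A"
  by (auto simp: FG_def reduced_winv fst_set_winv)

lemma finite_FG_bounded: "finite A \<Longrightarrow> finite {w \<in> FG A. length w \<le> n}"
  by (rule finite_subset[OF _ finite_lists_length_le[of "A \<times> UNIV" n]]) (auto simp: FG_def)

section \<open>Convex sets and their translates\<close>

lemma Conv_reduced: "\<xi> \<in> Conv A \<Longrightarrow> w \<in> \<xi> \<Longrightarrow> reduced w"
  by (auto simp: Conv_def FG_def)

lemma right_convexD: "right_convex \<xi> \<Longrightarrow> w \<in> \<xi> \<Longrightarrow> drop k w \<in> \<xi>"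
  by (auto simp: right_convex_def)

lemma right_convex_Cons: "right_convex \<xi> \<Longrightarrow> x # w \<in> \<xi> \<Longrightarrow> w \<in> \<xi>"
  using right_convexD[of \<xi> "x # w" 1] by simp

lemma right_convexI:
  assumes "\<And>x w. x # w \<in> \<xi> \<Longrightarrow> w \<in> \<xi>"
  shows "right_convex \<xi>"
  unfolding right_convex_def
proof (intro ballI allI)
  fix w k
  assume "w \<in> \<xi>"
  then show "drop k w \<in> \<xi>"
  proof (induction k arbitrary: w)
    case (Suc k)
    then show ?case using assms by (cases w) auto
  qed auto
qed

lemma right_convex_append: "right_convex \<xi> \<Longrightarrow> u @ v \<in> \<xi> \<Longrightarrow> v \<in> \<xi>"
  using right_convexD[of \<xi> "u @ v" "length u"] by simp

lemma mem_shift_act: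
  assumes "\<And>w. w \<in> \<xi> \<Longrightarrow> reduced w" "reduced \<alpha>"
  shows "w \<in> shift_act \<alpha> \<xi> \<longleftrightarrow> reduced w \<and> wmult w \<alpha> \<in> \<xi>"
proof
  assume "w \<in> shift_act \<alpha> \<xi>"
  then obtain v where v: "v \<in> \<xi>" "w = wmult v (winv \<alpha>)"
    by (auto simp: shift_act_def)
  then show "reduced w \<and> wmult w \<alpha> \<in> \<xi>"
    using assms by (auto simp: wmult_cancel_right' reduced_wmult reduced_winv)
next
  assume "reduced w \<and> wmult w \<alpha> \<in> \<xi>"
  then show "w \<in> shift_act \<alpha> \<xi>"
    unfolding shift_act_def using assms
    by (intro image_eqI[of _ _ "wmult w \<alpha>"]) (auto simp: wmult_cancel_right)
qed

lemma shift_act_Nil: "(\<And>w. w \<in> \<xi> \<Longrightarrow> reduced w) \<Longrightarrow> shift_act [] \<xi> = \<xi>"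
  by (auto simp: shift_act_def wmult_Nil_right image_iff)

text \<open>Cancellation consumes \<open>u\<close> from the right and \<open>v\<close> from the
  left. Either the head of \<open>u\<close> survives, or \<open>u\<close> is used up and a suffix of
  \<open>v\<close> remains.\<close>

lemma wmult_cases:
  assumes "reduced u" "reduced v"
  shows "(u \<noteq> [] \<and> wmult u v \<noteq> [] \<and> hd (wmult u v) = hd u) \<or> (\<exists>k. wmult u v = drop k v)"
  using assms(1)
proof (induction u)
  case Nil
  then show ?case by (auto intro: exI[of _ 0])
next
  case (Cons y u)
  show ?case
  proof (cases "reduced (y # wmult u v)")
    case True
    then show ?thesis by (simp add: cons_red_reduced)
  next
    case False
    have red: "reduced (wmult u v)" using assms by (simp add: reduced_wmult)
    have *: "wmult u v = letinv y # wmult (y # u) v"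
      using cons_red_not_reduced[OF red False] by simp
    then have "hd (wmult u v) = letinv y" by (metis list.sel(1))
    then obtain k where k: "wmult u v = drop k v"
      using Cons.IH Cons.prems unfolding reduced_Cons by metis
    have "wmult (y # u) v = drop (Suc k) v"
      using * k by (metis drop_Suc list.sel(3) tl_drop)
    then show ?thesis by blast
  qed
qed

text \<open>A right-convex set containing 1 is a subtree of the Cayley tree, and translation by one
  of its points only moves the root.\<close>

lemma right_convex_shift_act:
  assumes "\<And>w. w \<in> \<xi> \<Longrightarrow> reduced w" "right_convex \<xi>" "\<alpha> \<in> \<xi>"
  shows "right_convex (shift_act \<alpha> \<xi>)"
proof (rule right_convexI)
  fix x u
  have ra: "reduced \<alpha>" using assms by auto
  assume "x # u \<in> shift_act \<alpha> \<xi>"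
  then have r: "reduced (x # u)" and m: "cons_red x (wmult u \<alpha>) \<in> \<xi>"
    using mem_shift_act[OF assms(1) ra] by auto
  then have ru: "reduced u" by (simp add: reduced_Cons)
  have "wmult u \<alpha> \<in> \<xi>"
  proof (cases "reduced (x # wmult u \<alpha>)")
    case True
    then show ?thesis using m right_convex_Cons[OF assms(2)] by (simp add: cons_red_reduced)
  next
    \<comment> \<open>Here \<open>x\<close> cancels. As \<open>x # u\<close> is reduced, it does not
      cancel against a letter of \<open>u\<close>, so \<open>u\<close> is used up and
      \<open>wmult u \<alpha>\<close> is a suffix of \<open>\<alpha>\<close>.\<close>
    case False
    have red: "reduced (wmult u \<alpha>)" using ra by (simp add: reduced_wmult)
    have "hd (wmult u \<alpha>) = letinv x"
      using cons_red_not_reduced[OF red False] by (metis list.sel(1))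
    then obtain k where "wmult u \<alpha> = drop k \<alpha>"
      using wmult_cases[OF ru ra] r by (auto simp: reduced_Cons)
    then show ?thesis using assms right_convexD by metis
  qed
  then show "u \<in> shift_act \<alpha> \<xi>"
    using ru mem_shift_act[OF assms(1) ra] by simp
qed

lemma shift_act_Conv:
  assumes "\<xi> \<in> Conv A" "\<alpha> \<in> \<xi>"
  shows "shift_act \<alpha> \<xi> \<in> Conv A"
proof -
  have red: "\<And>w. w \<in> \<xi> \<Longrightarrow> reduced w" and conv: "right_convex \<xi>" and fg: "\<xi> \<subseteq> FG A"
    using assms by (auto simp: Conv_def FG_def)
  have "shift_act \<alpha> \<xi> \<subseteq> FG A"
    using fg assms(2) by (auto simp: shift_act_def intro: FG_wmult FG_winv)
  moreover have "[] \<in> shift_act \<alpha> \<xi>"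
    using mem_shift_act[OF red red[OF assms(2)]] assms(2) by simp
  ultimately show ?thesis
    using right_convex_shift_act[OF red conv assms(2)] by (simp add: Conv_def)
qed

lemma mem_local_config: "\<sigma> \<in> local_config E \<xi> g \<longleftrightarrow> fst \<sigma> \<in> E \<and> cons_red \<sigma> g \<in> \<xi>"
  by (simp add: local_config_def)

lemma local_config_shift_act:
  assumes "\<And>w. w \<in> \<xi> \<Longrightarrow> reduced w" "reduced g" "reduced h"
  shows "local_config E (shift_act g \<xi>) h = local_config E \<xi> (wmult h g)"
  using assms by (auto simp: mem_local_config mem_shift_act reduced_cons_red wmult_cons_red)

section \<open>Topology of sets of words\<close>

lemma openin_set_top_mem: "openin set_top {\<xi>. w \<in> \<xi>}" "openin set_top {\<xi>. w \<notin> \<xi>}"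
  by (auto simp: set_top_def intro!: topology_generated_by_Basis)

lemma topspace_set_top [simp]: "topspace set_top = UNIV"
proof -
  have "{\<xi>. [] \<in> \<xi>} \<union> {\<xi>. [] \<notin> \<xi>} \<subseteq> topspace (set_top :: 'a word set topology)"
    using openin_set_top_mem by (intro Un_least openin_subset) auto
  then show ?thesis by blast
qed

lemma openin_set_top_cylinder:
  "finite F \<Longrightarrow> openin set_top {\<zeta>. \<forall>w\<in>F. w \<in> \<zeta> \<longleftrightarrow> w \<in> \<xi>}"
proof (induction F rule: finite_induct)
  case empty
  then show ?case using openin_topspace[of set_top] by simp
next
  case (insert w F)
  have "{\<zeta>. \<forall>v\<in>insert w F. v \<in> \<zeta> \<longleftrightarrow> v \<in> \<xi>} =
      (if w \<in> \<xi> then {\<zeta>. w \<in> \<zeta>} else {\<zeta>. w \<notin> \<zeta>}) \<inter> {\<zeta>. \<forall>v\<in>F. v \<in> \<zeta> \<longleftrightarrow> v \<in> \<xi>}"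
    by auto
  then show ?case using insert openin_set_top_mem by (auto intro!: openin_Int)
qed

lemma continuous_map_set_top:
  fixes f :: "'x \<Rightarrow> 'b word set"
  assumes "\<And>w b. openin T {x \<in> topspace T. w \<in> f x \<longleftrightarrow> b}"
  shows "continuous_map T set_top f"
  unfolding set_top_def
proof (rule continuous_on_generated_topo)
  fix Z :: "'b word set set"
  assume "Z \<in> {{\<xi>. w \<in> \<xi>} |w. True} \<union> {{\<xi>. w \<notin> \<xi>} |w. True}"
  then obtain w b where "Z = {\<xi>. w \<in> \<xi> \<longleftrightarrow> b}"
    by (auto intro: that[of _ True] that[of _ False])
  then have "f -` Z \<inter> topspace T = {x \<in> topspace T. w \<in> f x \<longleftrightarrow> b}"
    by auto
  then show "openin T (f -` Z \<inter> topspace T)"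
    using assms by simp
qed auto

section \<open>Continuity between transformation groupoids\<close>

lemma topspace_ta_top:
  "U \<subseteq> topspace X \<Longrightarrow> topspace (ta_top G X D act U) = ta_arrows G D act U"
  by (auto simp: ta_top_def ta_arrows_def)

text \<open>The group coordinate is discrete. With it fixed, it suffices that finitely many
  membership bits of the given set decide the group coordinate of the image and any single bit of
  its set.\<close>

lemma continuous_map_ta_top:
  fixes f :: "'a word \<times> 'b word set \<Rightarrow> 'c word \<times> 'd word set"
  assumes arrows: "\<And>g \<xi>. (g, \<xi>) \<in> ta_arrows G D act U \<Longrightarrow> f (g, \<xi>) \<in> ta_arrows H D' act' U'"
    and sub: "U \<subseteq> \<Omega>" "U' \<subseteq> \<Omega>'"
    and local: "\<And>g \<xi> w. (g, \<xi>) \<in> ta_arrows G D act U \<Longrightarrow>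
      \<exists>F. finite F \<and> (\<forall>\<zeta>. (g, \<zeta>) \<in> ta_arrows G D act U \<longrightarrow> (\<forall>v\<in>F. v \<in> \<zeta> \<longleftrightarrow> v \<in> \<xi>) \<longrightarrow>
        fst (f (g, \<zeta>)) = fst (f (g, \<xi>)) \<and> (w \<in> snd (f (g, \<zeta>)) \<longleftrightarrow> w \<in> snd (f (g, \<xi>))))"
  shows "continuous_map (ta_top G (subtopology set_top \<Omega>) D act U)
      (ta_top H (subtopology set_top \<Omega>') D' act' U') f"
proof -
  let ?T = "ta_top G (subtopology set_top \<Omega>) D act U"
  let ?R = "ta_arrows G D act U"
  have topR: "topspace ?T = ?R"
    using sub by (simp add: topspace_ta_top)
  have R': "h \<in> H \<and> z \<in> U'" if "(h, z) \<in> ta_arrows H D' act' U'" for h z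
    using that by (auto simp: ta_arrows_def)
  have fR: "fst (f p) \<in> H" "snd (f p) \<in> U'" if "p \<in> ?R" for p
    using arrows[of "fst p" "snd p"] that R'[of "fst (f p)" "snd (f p)"] by auto
  have cyl: "openin ?T {(h, \<zeta>) \<in> ?R. h = g \<and> (\<forall>v\<in>F. v \<in> \<zeta> \<longleftrightarrow> v \<in> \<xi>)}"
    if "finite F" "(g, \<xi>) \<in> ?R" for F g \<xi>
  proof -
    have "openin (prod_topology (discrete_topology G) (subtopology set_top \<Omega>))
        ({g} \<times> ({\<zeta>. \<forall>v\<in>F. v \<in> \<zeta> \<longleftrightarrow> v \<in> \<xi>} \<inter> \<Omega>))"
      using that openin_set_top_cylinder[of F \<xi>]
      by (auto simp: openin_prod_Times_iff ta_arrows_def openin_subtopology)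
    then have "openin ?T (({g} \<times> ({\<zeta>. \<forall>v\<in>F. v \<in> \<zeta> \<longleftrightarrow> v \<in> \<xi>} \<inter> \<Omega>)) \<inter> ?R)"
      unfolding ta_top_def openin_subtopology by blast
    moreover have "({g} \<times> ({\<zeta>. \<forall>v\<in>F. v \<in> \<zeta> \<longleftrightarrow> v \<in> \<xi>} \<inter> \<Omega>)) \<inter> ?R
        = {(h, \<zeta>) \<in> ?R. h = g \<and> (\<forall>v\<in>F. v \<in> \<zeta> \<longleftrightarrow> v \<in> \<xi>)}"
      using sub by (auto simp: ta_arrows_def)
    ultimately show ?thesis by simp
  qed
  \<comment> \<open>A property of arrows decided by finitely many bits is open, since it contains a
    cylinder around each of its arrows.\<close>
  have op: "openin ?T {p \<in> ?R. P p}"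
    if P: "\<And>g \<xi>. (g, \<xi>) \<in> ?R \<Longrightarrow> P (g, \<xi>) \<Longrightarrow>
      \<exists>F. finite F \<and> (\<forall>\<zeta>. (g, \<zeta>) \<in> ?R \<longrightarrow> (\<forall>v\<in>F. v \<in> \<zeta> \<longleftrightarrow> v \<in> \<xi>) \<longrightarrow> P (g, \<zeta>))" for P
  proof (subst openin_subopen, rule ballI)
    fix p
    assume p: "p \<in> {p \<in> ?R. P p}"
    obtain g \<xi> where g: "p = (g, \<xi>)" by (cases p)
    with p have p1: "(g, \<xi>) \<in> ?R" and p2: "P (g, \<xi>)" by auto
    obtain F where F1: "finite F"
      and F2: "\<forall>\<zeta>. (g, \<zeta>) \<in> ?R \<longrightarrow> (\<forall>v\<in>F. v \<in> \<zeta> \<longleftrightarrow> v \<in> \<xi>) \<longrightarrow> P (g, \<zeta>)"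
      using P[OF p1 p2] by (elim exE conjE) (rule that)
    have "{(h, \<zeta>) \<in> ?R. h = g \<and> (\<forall>v\<in>F. v \<in> \<zeta> \<longleftrightarrow> v \<in> \<xi>)} \<subseteq> {p \<in> ?R. P p}"
      using F2 by auto
    moreover have "p \<in> {(h, \<zeta>) \<in> ?R. h = g \<and> (\<forall>v\<in>F. v \<in> \<zeta> \<longleftrightarrow> v \<in> \<xi>)}"
      using p1 g by simp
    ultimately show "\<exists>T. openin ?T T \<and> p \<in> T \<and> T \<subseteq> {p \<in> ?R. P p}"
      using cyl[OF F1 p1] by meson
  qed
  have fst_open: "openin ?T {p \<in> ?R. fst (f p) \<in> Z}" for Z
  proof (rule op)
    fix g \<xi>
    assume p: "(g, \<xi>) \<in> ?R" "fst (f (g, \<xi>)) \<in> Z"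
    show "\<exists>F. finite F \<and> (\<forall>\<zeta>. (g, \<zeta>) \<in> ?R \<longrightarrow> (\<forall>v\<in>F. v \<in> \<zeta> \<longleftrightarrow> v \<in> \<xi>) \<longrightarrow> fst (f (g, \<zeta>)) \<in> Z)"
      using local[OF p(1), of "[]"] by (rule ex_forward) (use p(2) in auto)
  qed
  have snd_open: "openin ?T {p \<in> ?R. w \<in> snd (f p) \<longleftrightarrow> b}" for w b
  proof (rule op)
    fix g \<xi>
    assume p: "(g, \<xi>) \<in> ?R" "w \<in> snd (f (g, \<xi>)) \<longleftrightarrow> b"
    show "\<exists>F. finite F \<and> (\<forall>\<zeta>. (g, \<zeta>) \<in> ?R \<longrightarrow> (\<forall>v\<in>F. v \<in> \<zeta> \<longleftrightarrow> v \<in> \<xi>) \<longrightarrow>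
        (w \<in> snd (f (g, \<zeta>)) \<longleftrightarrow> b))"
      using local[OF p(1), of w] by (rule ex_forward) (use p(2) in auto)
  qed
  have c1: "continuous_map ?T (discrete_topology H) (fst \<circ> f)"
    using fst_open fR by (auto simp: continuous_map_def topR)
  have "continuous_map ?T set_top (snd \<circ> f)"
    using snd_open by (intro continuous_map_set_top) (simp add: topR)
  then have c2: "continuous_map ?T (subtopology set_top \<Omega>') (snd \<circ> f)"
    using fR sub by (auto simp: continuous_map_in_subtopology topR)
  show ?thesis
    unfolding ta_top_def[of H]
    using c1 c2 arrows
    by (auto simp: continuous_map_in_subtopology continuous_map_pairwise topR)
qed

section \<open>The separated graph of allowed balls\<close>

text \<open>An edge \<open>ed B w\<close> is an allowed \<open>N\<close>-ball \<open>B\<close> together with a word \<open>w \<in> B\<close> of length at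
  most one. Its source is (the vertex of) \<open>B\<close>. The edges with \<open>w = 1\<close> are dead ends; they only
  ensure that every ball emits an edge.\<close>

locale ball_graph =
  fixes A :: "'a set" and \<Omega> :: "'a word set set" and N :: nat and \<G> :: "'a word set set"
    and E1 :: "'e set" and st :: "'e \<Rightarrow> 'a word set" and lt :: "'e \<Rightarrow> 'a word"
    and ed :: "'a word set \<Rightarrow> 'a word \<Rightarrow> 'e"
  assumes finite_A: "finite A"
    and finite_E1: "finite E1"
    and N: "1 \<le> N"
    and Omega_iff: "\<And>\<eta>. \<eta> \<in> \<Omega> \<longleftrightarrow> \<eta> \<in> Conv A \<and> (\<forall>\<alpha>\<in>\<eta>. trunc N (shift_act \<alpha> \<eta>) \<in> \<G>)"
    and Omega_shift: "\<And>\<eta> \<alpha>. \<eta> \<in> \<Omega> \<Longrightarrow> \<alpha> \<in> \<eta> \<Longrightarrow> shift_act \<alpha> \<eta> \<in> \<Omega>"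
    and ball_ex: "\<And>B. B \<in> \<G> \<Longrightarrow> \<exists>\<eta>\<in>\<Omega>. B = trunc N \<eta>"
    and ed: "\<And>B w. B \<in> \<G> \<Longrightarrow> w \<in> B \<Longrightarrow> length w \<le> 1 \<Longrightarrow>
      ed B w \<in> E1 \<and> st (ed B w) = B \<and> lt (ed B w) = w"
    and edge: "\<And>e. e \<in> E1 \<Longrightarrow> st e \<in> \<G> \<and> lt e \<in> st e \<and> length (lt e) \<le> 1 \<and> ed (st e) (lt e) = e"
begin

abbreviation lc :: "'e word set \<Rightarrow> 'e word \<Rightarrow> ('e \<times> bool) set" where
  "lc \<equiv> local_config E1"

lemma edge_eqI: "e \<in> E1 \<Longrightarrow> e' \<in> E1 \<Longrightarrow> st e = st e' \<Longrightarrow> lt e = lt e' \<Longrightarrow> e = e'"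
  using edge by metis

lemma Omega_Conv: "\<eta> \<in> \<Omega> \<Longrightarrow> \<eta> \<in> Conv A"
  using Omega_iff by blast

lemma Omega_reduced: "\<eta> \<in> \<Omega> \<Longrightarrow> \<alpha> \<in> \<eta> \<Longrightarrow> reduced \<alpha>"
  using Omega_Conv Conv_reduced by blast

lemma Omega_convex: "\<eta> \<in> \<Omega> \<Longrightarrow> right_convex \<eta>"
  using Omega_Conv by (auto simp: Conv_def)

lemma Omega_Nil: "\<eta> \<in> \<Omega> \<Longrightarrow> [] \<in> \<eta>"
  using Omega_Conv by (auto simp: Conv_def)

lemma ball_Conv: "B \<in> \<G> \<Longrightarrow> B \<in> Conv A"
  using ball_ex Omega_Conv by (fastforce simp: Conv_def trunc_def right_convex_def)

lemma ball_Nil: "B \<in> \<G> \<Longrightarrow> [] \<in> B"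
  using ball_Conv by (auto simp: Conv_def)

lemma ball_reduced: "B \<in> \<G> \<Longrightarrow> w \<in> B \<Longrightarrow> reduced w"
  using ball_Conv Conv_reduced by blast

lemma ball_length: "B \<in> \<G> \<Longrightarrow> w \<in> B \<Longrightarrow> length w \<le> N"
  using ball_ex by (fastforce simp: trunc_def)

lemma ball_last: "B \<in> \<G> \<Longrightarrow> w @ [\<sigma>] \<in> B \<Longrightarrow> [\<sigma>] \<in> B"
  using ball_Conv right_convex_append by (fastforce simp: Conv_def)

text \<open>The vertex carried by the point \<open>\<alpha>\<close>; this is the sliding block code
  from \<eta> to balls of radius \<open>N\<close>.\<close>

definition state :: "'a word set \<Rightarrow> 'a word \<Rightarrow> 'a word set" where
  "state \<eta> \<alpha> = trunc N (shift_act \<alpha> \<eta>)"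

lemma mem_state:
  "\<eta> \<in> Conv A \<Longrightarrow> \<alpha> \<in> \<eta> \<Longrightarrow> w \<in> state \<eta> \<alpha> \<longleftrightarrow> reduced w \<and> length w \<le> N \<and> wmult w \<alpha> \<in> \<eta>"
  using mem_shift_act[of \<eta> \<alpha> w] Conv_reduced by (auto simp: state_def trunc_def)

lemma state_ball: "\<eta> \<in> \<Omega> \<Longrightarrow> \<alpha> \<in> \<eta> \<Longrightarrow> state \<eta> \<alpha> \<in> \<G>"
  using Omega_iff by (auto simp: state_def)

lemma letter_state: "\<eta> \<in> \<Omega> \<Longrightarrow> \<alpha> \<in> \<eta> \<Longrightarrow> [\<sigma>] \<in> state \<eta> \<alpha> \<longleftrightarrow> cons_red \<sigma> \<alpha> \<in> \<eta>"
  using N by (simp add: mem_state Omega_Conv)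

definition out :: "'a word set \<Rightarrow> ('e \<times> bool) set" where
  "out B = {(e, True) |e. e \<in> E1 \<and> st e = B}"

text \<open>The balls of \<open>e\<close> and \<open>e'\<close> agree wherever they overlap when centred at the two ends of an
  edge labelled by the letter \<open>\<sigma>\<close>. In a tree, the part of the ball of \<open>e'\<close> outside the overlap lies
  beyond \<open>\<sigma>\<close>, so that matching balls can be chosen independently for distinct letters.\<close>

definition match :: "'e \<Rightarrow> 'e \<Rightarrow> bool" where
  "match e e' \<longleftrightarrow> (\<exists>\<sigma>. lt e = [\<sigma>] \<and> lt e' = [letinv \<sigma>] \<and>
     (\<forall>w. reduced w \<longrightarrow> length w \<le> N \<longrightarrow> length (wmult w [\<sigma>]) \<le> N \<longrightarrow>
        (w \<in> st e' \<longleftrightarrow> wmult w [\<sigma>] \<in> st e)))"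

lemma match_lt: "match e e' \<Longrightarrow> lt e = [\<sigma>] \<Longrightarrow> lt e' = [letinv \<sigma>]"
  by (auto simp: match_def)

lemma match_mem:
  "match e e' \<Longrightarrow> lt e = [\<sigma>] \<Longrightarrow> reduced w \<Longrightarrow> length w \<le> N \<Longrightarrow> length (wmult w [\<sigma>]) \<le> N \<Longrightarrow>
    w \<in> st e' \<longleftrightarrow> wmult w [\<sigma>] \<in> st e"
  by (auto simp: match_def)

lemma match_sym: "match e e' \<Longrightarrow> match e' e"
proof -
  assume m: "match e e'"
  then obtain \<sigma> where \<sigma>: "lt e = [\<sigma>]" "lt e' = [letinv \<sigma>]" by (auto simp: match_def)
  have "w \<in> st e \<longleftrightarrow> wmult w [letinv \<sigma>] \<in> st e'"
    if w: "reduced w" "length w \<le> N" "length (wmult w [letinv \<sigma>]) \<le> N" for w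
  proof -
    have "wmult (wmult w [letinv \<sigma>]) [\<sigma>] = w"
      using wmult_cancel_right'[of "[\<sigma>]" w] w by simp
    then show ?thesis
      using match_mem[OF m \<sigma>(1), of "wmult w [letinv \<sigma>]"] w by (simp add: reduced_wmult)
  qed
  then show ?thesis using \<sigma> by (auto simp: match_def)
qed

lemma match_neq: "match e e' \<Longrightarrow> e \<noteq> e'"
  by (auto simp: match_def)

text \<open>This is \<open>OmegaEC\<close> with the vertices eliminated: the alternatives are a
  ball, the range of a dead end and the range of a letter. Equality of ranges is expressed by
  \<open>match\<close>, which keeps the equivalence independent of any encoding of vertices.\<close>

definition graph_shift :: "'e word set set" where
  "graph_shift = {\<xi>. \<xi> \<subseteq> FG E1 \<and> [] \<in> \<xi> \<and> right_convex \<xi> \<and>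
     (\<forall>g\<in>\<xi>. (\<exists>B\<in>\<G>. lc \<xi> g = out B) \<or>
       (\<exists>e\<in>E1. lt e = [] \<and> lc \<xi> g = {(e, False)}) \<or>
       (\<exists>e\<in>E1. \<exists>e'\<in>E1. match e e' \<and> lc \<xi> g = {(e, False), (e', False)}))}"

lemma graph_shift_reduced: "\<xi> \<in> graph_shift \<Longrightarrow> g \<in> \<xi> \<Longrightarrow> reduced g"
  by (auto simp: graph_shift_def FG_def)

lemma graph_shift_shift_act:
  assumes \<xi>: "\<xi> \<in> graph_shift" and g: "g \<in> \<xi>"
  shows "shift_act g \<xi> \<in> graph_shift"
proof -
  have red: "\<And>w. w \<in> \<xi> \<Longrightarrow> reduced w" using \<xi> by (rule graph_shift_reduced)
  have "\<xi> \<in> Conv E1" using \<xi> by (auto simp: graph_shift_def Conv_def)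
  then have C: "shift_act g \<xi> \<in> Conv E1" using g by (rule shift_act_Conv)
  have "reduced h \<and> wmult h g \<in> \<xi> \<and> lc (shift_act g \<xi>) h = lc \<xi> (wmult h g)"
    if "h \<in> shift_act g \<xi>" for h
    using that mem_shift_act[OF red red[OF g]] local_config_shift_act[OF red red[OF g]] by simp
  then show ?thesis
    using C \<xi> by (auto simp: graph_shift_def Conv_def)
qed

section \<open>Lifting allowed configurations\<close>

text \<open>To cross \<open>\<sigma>\<close>, the path leaves the ball at \<open>\<alpha>\<close> by
  its edge for \<open>\<sigma>\<close> and enters the next ball against that ball's edge for
  \<open>letinv \<sigma>\<close>. With \<open>cons_red\<close> the value is reduced for every
  argument; for \<eta> in \<Omega> nothing cancels on the points of \<eta>.\<close>

primrec lift :: "'a word set \<Rightarrow> 'a word \<Rightarrow> 'e word" where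
  "lift \<eta> [] = []"
| "lift \<eta> (\<sigma> # \<alpha>) = cons_red (ed (state \<eta> (\<sigma> # \<alpha>)) [letinv \<sigma>], False)
     (cons_red (ed (state \<eta> \<alpha>) [\<sigma>], True) (lift \<eta> \<alpha>))"

lemma edge_state:
  assumes "\<eta> \<in> \<Omega>" "\<alpha> \<in> \<eta>" "cons_red \<sigma> \<alpha> \<in> \<eta>"
  shows "ed (state \<eta> \<alpha>) [\<sigma>] \<in> E1" "st (ed (state \<eta> \<alpha>) [\<sigma>]) = state \<eta> \<alpha>"
    "lt (ed (state \<eta> \<alpha>) [\<sigma>]) = [\<sigma>]"
  using ed[of "state \<eta> \<alpha>" "[\<sigma>]"] assms by (auto simp: state_ball letter_state)

lemma edge_state':
  assumes "\<eta> \<in> \<Omega>" "\<alpha> \<in> \<eta>" "cons_red \<sigma> \<alpha> \<in> \<eta>"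
  shows "ed (state \<eta> (cons_red \<sigma> \<alpha>)) [letinv \<sigma>] \<in> E1"
    "st (ed (state \<eta> (cons_red \<sigma> \<alpha>)) [letinv \<sigma>]) = state \<eta> (cons_red \<sigma> \<alpha>)"
    "lt (ed (state \<eta> (cons_red \<sigma> \<alpha>)) [letinv \<sigma>]) = [letinv \<sigma>]"
  using edge_state[of \<eta> "cons_red \<sigma> \<alpha>" "letinv \<sigma>"] assms
  by (simp_all add: cons_red_letinv Omega_reduced)

text \<open>Both balls are cut out of the same \<eta>, so they agree on the overlap by
  associativity.\<close>

lemma match_state:
  assumes "\<eta> \<in> \<Omega>" "\<alpha> \<in> \<eta>" "cons_red \<sigma> \<alpha> \<in> \<eta>"
  shows "match (ed (state \<eta> \<alpha>) [\<sigma>]) (ed (state \<eta> (cons_red \<sigma> \<alpha>)) [letinv \<sigma>])"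
  unfolding match_def
  using assms
  by (intro exI[of _ \<sigma>])
    (simp add: edge_state edge_state' mem_state Omega_Conv reduced_wmult wmult_assoc Omega_reduced)

lemma reduced_lift: "reduced (lift \<eta> \<alpha>)"
  by (induction \<alpha>) (auto simp: reduced_cons_red)

text \<open>The labels prevent cancellation. The two edges of one letter carry
  \<open>\<sigma>\<close> and its inverse; the edge by which the path entered the ball at
  \<open>\<tau> # \<beta>\<close> carries \<open>letinv \<tau>\<close>, which differs from
  \<open>\<sigma>\<close> in a reduced word.\<close>

lemma lift_Cons:
  assumes "\<eta> \<in> \<Omega>" "\<sigma> # \<alpha> \<in> \<eta>"
  shows "lift \<eta> (\<sigma> # \<alpha>) =
    (ed (state \<eta> (\<sigma> # \<alpha>)) [letinv \<sigma>], False) # (ed (state \<eta> \<alpha>) [\<sigma>], True) # lift \<eta> \<alpha>"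
  using assms(2)
proof (induction \<alpha> arbitrary: \<sigma>)
  case Nil
  have e: "cons_red \<sigma> [] = [\<sigma>]" by (simp add: cons_red_def)
  have "ed (state \<eta> [\<sigma>]) [letinv \<sigma>] \<noteq> ed (state \<eta> []) [\<sigma>]"
    using edge_state(3)[of \<eta> "[]" \<sigma>] edge_state'(3)[of \<eta> "[]" \<sigma>] Nil assms
    by (metis Omega_Nil e letinv_neq(1) list.inject)
  then show ?case by (auto simp: cons_red_def)
next
  case (Cons \<tau> \<beta>)
  let ?e = "ed (state \<eta> (\<tau> # \<beta>)) [\<sigma>]" and ?e' = "ed (state \<eta> (\<sigma> # \<tau> # \<beta>)) [letinv \<sigma>]"
  have m: "\<tau> # \<beta> \<in> \<eta>" "\<beta> \<in> \<eta>"
    using Cons.prems assms Omega_convex right_convex_Cons by blast+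
  have r: "reduced (\<sigma> # \<tau> # \<beta>)" using Cons.prems assms Omega_reduced by blast
  then have c: "cons_red \<sigma> (\<tau> # \<beta>) = \<sigma> # \<tau> # \<beta>" "cons_red \<tau> \<beta> = \<tau> # \<beta>"
    by (simp_all add: cons_red_reduced)
  have 1: "lt ?e = [\<sigma>]" "lt ?e' = [letinv \<sigma>]"
    using edge_state(3)[of \<eta> "\<tau> # \<beta>" \<sigma>] edge_state'(3)[of \<eta> "\<tau> # \<beta>" \<sigma>] Cons.prems assms m c by simp_all
  have 2: "lt (ed (state \<eta> (\<tau> # \<beta>)) [letinv \<tau>]) = [letinv \<tau>]"
    using edge_state'(3)[of \<eta> \<beta> \<tau>] assms m c by simp
  have "\<tau> \<noteq> letinv \<sigma>" using r by simp
  then have 3: "ed (state \<eta> (\<tau> # \<beta>)) [letinv \<tau>] \<noteq> ?e"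
    using 1 2 by (metis letinv_letinv list.inject)
  have 4: "?e \<noteq> ?e'" using 1 by (metis letinv_neq(1) list.inject)
  show ?case
    unfolding lift.simps(2)[of \<eta> \<sigma>] Cons.IH[OF m(1)] using 3 4 by (simp add: cons_red_def)
qed

text \<open>If \<open>\<sigma>\<close> cancels, the path retraces the last two edges of the lift,
  because a letter and its inverse use the same pair of edges in opposite directions.\<close>

lemma lift_cons_red:
  assumes "\<eta> \<in> \<Omega>" "\<alpha> \<in> \<eta>" "cons_red \<sigma> \<alpha> \<in> \<eta>"
  shows "lift \<eta> (cons_red \<sigma> \<alpha>) = cons_red (ed (state \<eta> (cons_red \<sigma> \<alpha>)) [letinv \<sigma>], False)
    (cons_red (ed (state \<eta> \<alpha>) [\<sigma>], True) (lift \<eta> \<alpha>))"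
proof (cases "reduced (\<sigma> # \<alpha>)")
  case True
  then show ?thesis by (simp add: cons_red_reduced)
next
  case False
  define \<beta> where "\<beta> = cons_red \<sigma> \<alpha>"
  have a: "\<alpha> = letinv \<sigma> # \<beta>"
    using cons_red_not_reduced False assms Omega_reduced \<beta>_def by blast
  have "lift \<eta> \<alpha> = (ed (state \<eta> \<alpha>) [\<sigma>], False) # (ed (state \<eta> \<beta>) [letinv \<sigma>], True) # lift \<eta> \<beta>"
    using lift_Cons[of \<eta> "letinv \<sigma>" \<beta>] assms a by simp
  then show ?thesis
    unfolding \<beta>_def[symmetric] by (simp add: cons_red_def)
qed

lemma length_lift: "\<eta> \<in> \<Omega> \<Longrightarrow> \<alpha> \<in> \<eta> \<Longrightarrow> length (lift \<eta> \<alpha>) = 2 * length \<alpha>"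
proof (induction \<alpha>)
  case (Cons \<sigma> \<alpha>)
  then have "\<alpha> \<in> \<eta>" using Omega_convex right_convex_Cons by blast
  then show ?case using Cons lift_Cons by simp
qed simp

lemma lift_FG: "\<eta> \<in> \<Omega> \<Longrightarrow> \<alpha> \<in> \<eta> \<Longrightarrow> lift \<eta> \<alpha> \<in> FG E1"
proof (induction \<alpha>)
  case (Cons \<sigma> \<alpha>)
  then have a: "\<alpha> \<in> \<eta>" using Omega_convex right_convex_Cons by blast
  have "cons_red \<sigma> \<alpha> = \<sigma> # \<alpha>" using Cons Omega_reduced cons_red_reduced by blast
  then show ?case
    using edge_state(1)[of \<eta> \<alpha> \<sigma>] edge_state'(1)[of \<eta> \<alpha> \<sigma>] Cons a by (simp add: FG_cons_red)
qed simp

text \<open>The homomorphism \<open>F(E1) \<rightarrow> F(A)\<close> sending an edge to its letter if that letter is positive, and to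
  1 otherwise. Thus for matching \<open>e\<close> and \<open>e'\<close> the word \<open>e'\<^sup>-\<^sup>1 e\<close> is sent to the letter of \<open>e\<close>.\<close>

definition gen :: "'e \<times> bool \<Rightarrow> 'a word" where
  "gen x = (let w = take 1 (filter snd (lt (fst x))) in if snd x then w else winv w)"

primrec proj :: "'e word \<Rightarrow> 'a word" where
  "proj [] = []"
| "proj (x # g) = wmult (gen x) (proj g)"

lemma gen_letinv: "gen (letinv x) = winv (gen x)"
  by (simp add: gen_def letinv_def Let_def)

lemma reduced_proj: "reduced (proj g)"
  by (induction g) (auto simp: reduced_wmult)

lemma proj_cons_red: "proj (cons_red x g) = wmult (gen x) (proj g)"
proof (cases g)
  case (Cons y h)
  then show ?thesis
    using wmult_winv_cancel[of "proj h" "winv (gen x)"]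
    by (auto simp: cons_red_def gen_letinv reduced_proj)
qed (simp add: cons_red_def)

lemma proj_wmult: "proj (wmult g h) = wmult (proj g) (proj h)"
  by (induction g) (auto simp: proj_cons_red wmult_assoc reduced_proj)

lemma proj_winv: "reduced g \<Longrightarrow> proj (winv g) = winv (proj g)"
  using proj_wmult[of "winv g" g] wmult_cancel_right[of "proj g" "proj (winv g)"]
  by (simp add: wmult_winv_left reduced_proj)

lemma gen_match:
  assumes "lt e = [\<sigma>]" "lt e' = [letinv \<sigma>]"
  shows "wmult (gen (e', False)) (wmult (gen (e, True)) w) = cons_red \<sigma> w"
  using assms by (cases \<sigma>; cases "snd \<sigma>") (auto simp: gen_def)

lemma proj_lift: "\<eta> \<in> \<Omega> \<Longrightarrow> \<alpha> \<in> \<eta> \<Longrightarrow> proj (lift \<eta> \<alpha>) = \<alpha>"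
proof (induction \<alpha>)
  case (Cons \<sigma> \<alpha>)
  then have a: "\<alpha> \<in> \<eta>" using Omega_convex right_convex_Cons by blast
  have c: "cons_red \<sigma> \<alpha> = \<sigma> # \<alpha>" using Cons Omega_reduced cons_red_reduced by blast
  then have "lt (ed (state \<eta> \<alpha>) [\<sigma>]) = [\<sigma>]" "lt (ed (state \<eta> (\<sigma> # \<alpha>)) [letinv \<sigma>]) = [letinv \<sigma>]"
    using edge_state(3)[of \<eta> \<alpha> \<sigma>] edge_state'(3)[of \<eta> \<alpha> \<sigma>] Cons a by simp_all
  from gen_match[OF this, of \<alpha>] show ?case
    using lift_Cons[of \<eta> \<sigma> \<alpha>] Cons a c by simp
qed simp

lemma lift_inj: "\<eta> \<in> \<Omega> \<Longrightarrow> \<alpha> \<in> \<eta> \<Longrightarrow> \<beta> \<in> \<eta> \<Longrightarrow> lift \<eta> \<alpha> = lift \<eta> \<beta> \<Longrightarrow> \<alpha> = \<beta>"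
  using proj_lift by metis

text \<open>The second set adds the far ends of the edges leaving lifted points: the midpoints of
  letters and the dead ends. Such an edge may retrace the last step of the lift, hence
  \<open>cons_red\<close>.\<close>

definition tree :: "'a word set \<Rightarrow> 'e word set" where
  "tree \<eta> = lift \<eta> ` \<eta> \<union> {cons_red (e, True) (lift \<eta> \<alpha>) |\<alpha> e. \<alpha> \<in> \<eta> \<and> e \<in> E1 \<and> st e = state \<eta> \<alpha>}"

lemma lift_tree: "\<alpha> \<in> \<eta> \<Longrightarrow> lift \<eta> \<alpha> \<in> tree \<eta>"
  by (auto simp: tree_def)

lemma tree_outI: "\<alpha> \<in> \<eta> \<Longrightarrow> e \<in> E1 \<Longrightarrow> st e = state \<eta> \<alpha> \<Longrightarrow> cons_red (e, True) (lift \<eta> \<alpha>) \<in> tree \<eta>"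
  by (auto simp: tree_def)

lemma tree_cases:
  assumes "\<eta> \<in> \<Omega>" "g \<in> tree \<eta>"
  obtains (even) \<alpha> where "\<alpha> \<in> \<eta>" "g = lift \<eta> \<alpha>"
  | (odd) \<alpha> e where "\<alpha> \<in> \<eta>" "e \<in> E1" "st e = state \<eta> \<alpha>" "g = (e, True) # lift \<eta> \<alpha>" "reduced g"
proof (cases "g \<in> lift \<eta> ` \<eta>")
  case True
  then show thesis using even by blast
next
  case False
  then obtain \<alpha> e where g: "\<alpha> \<in> \<eta>" "e \<in> E1" "st e = state \<eta> \<alpha>" "g = cons_red (e, True) (lift \<eta> \<alpha>)"
    using assms(2) by (auto simp: tree_def)
  show thesis
  proof (cases "reduced ((e, True) # lift \<eta> \<alpha>)")
    case True
    then show thesis using odd g cons_red_reduced by metis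
  next
    case False
    \<comment> \<open>A cancelling edge leads back to the midpoint of the last letter. This is also
      the far end of an edge leaving the previous point \<open>\<beta>\<close>, where no
      cancellation occurs.\<close>
    have l: "lift \<eta> \<alpha> = (e, False) # g"
      using cons_red_not_reduced[OF reduced_lift False] g by simp
    then obtain \<sigma> \<beta> where a: "\<alpha> = \<sigma> # \<beta>" by (cases \<alpha>) auto
    have b: "\<beta> \<in> \<eta>" "cons_red \<sigma> \<beta> \<in> \<eta>"
      using a g assms Omega_convex right_convex_Cons cons_red_reduced Omega_reduced by metis+
    have "g = (ed (state \<eta> \<beta>) [\<sigma>], True) # lift \<eta> \<beta>"
      using lift_Cons[of \<eta> \<sigma> \<beta>] assms g(1) a l by simp
    moreover have "reduced g" using l reduced_lift[of \<eta> \<alpha>] by (simp add: reduced_Cons)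
    ultimately show thesis
      using odd[OF b(1) edge_state(1,2)[OF assms(1) b]] by blast
  qed
qed

lemma tree_lift_parity:
  assumes "\<eta> \<in> \<Omega>" "g \<in> tree \<eta>" "even (length g)"
  shows "\<exists>\<alpha>\<in>\<eta>. g = lift \<eta> \<alpha>"
  using assms(1,2)
proof (cases rule: tree_cases)
  case (odd \<alpha> e)
  then show ?thesis using assms length_lift by simp
qed auto

lemma tree_odd:
  assumes "\<eta> \<in> \<Omega>" "g \<in> tree \<eta>" "odd (length g)"
  obtains \<alpha> e where "\<alpha> \<in> \<eta>" "e \<in> E1" "st e = state \<eta> \<alpha>" "g = (e, True) # lift \<eta> \<alpha>" "reduced g"
  using assms(1,2)
proof (cases rule: tree_cases)
  case (even \<alpha>)
  then show ?thesis using assms length_lift by simp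
qed (use that in auto)

lemma lc_tree_lift:
  assumes "\<eta> \<in> \<Omega>" "\<alpha> \<in> \<eta>"
  shows "lc (tree \<eta>) (lift \<eta> \<alpha>) = out (state \<eta> \<alpha>)"
proof (intro equalityI subsetI)
  fix x
  assume "x \<in> out (state \<eta> \<alpha>)"
  then show "x \<in> lc (tree \<eta>) (lift \<eta> \<alpha>)"
    using assms by (auto simp: out_def mem_local_config tree_outI)
next
  fix x
  assume "x \<in> lc (tree \<eta>) (lift \<eta> \<alpha>)"
  then have x: "fst x \<in> E1" "cons_red x (lift \<eta> \<alpha>) \<in> tree \<eta>" by (auto simp: mem_local_config)
  show "x \<in> out (state \<eta> \<alpha>)"
  proof (cases "reduced (x # lift \<eta> \<alpha>)")
    case True
    then have t: "x # lift \<eta> \<alpha> \<in> tree \<eta>" using x by (simp add: cons_red_reduced)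
    have "odd (length (x # lift \<eta> \<alpha>))" using length_lift[OF assms] by simp
    from tree_odd[OF assms(1) t this] obtain \<beta> e where "\<beta> \<in> \<eta>" "e \<in> E1" "st e = state \<eta> \<beta>" "x # lift \<eta> \<alpha> = (e, True) # lift \<eta> \<beta>"
      by metis
    then show ?thesis using assms lift_inj by (auto simp: out_def)
  next
    \<comment> \<open>Here \<open>x\<close> undoes the last edge of the lift, so it is the edge of
      this ball towards the preceding point.\<close>
    case False
    have l: "lift \<eta> \<alpha> = letinv x # cons_red x (lift \<eta> \<alpha>)"
      using cons_red_not_reduced[OF reduced_lift False] .
    then obtain \<sigma> \<beta> where a: "\<alpha> = \<sigma> # \<beta>" by (cases \<alpha>) auto
    have b: "\<beta> \<in> \<eta>" "cons_red \<sigma> \<beta> = \<alpha>"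
      using a assms Omega_convex right_convex_Cons cons_red_reduced Omega_reduced by metis+
    have "letinv x = (ed (state \<eta> \<alpha>) [letinv \<sigma>], False)"
      using lift_Cons[of \<eta> \<sigma> \<beta>] assms a l by simp
    then have "x = (ed (state \<eta> \<alpha>) [letinv \<sigma>], True)"
      by (metis letinv_Pair letinv_letinv not_False_eq_True)
    then show ?thesis
      using edge_state'[of \<eta> \<beta> \<sigma>] assms b by (simp add: out_def)
  qed
qed

text \<open>From a midpoint one can return to \<open>\<alpha>\<close> or go on across the letter.
  The second set is empty at a dead end, where \<open>lt e = []\<close>.\<close>

lemma lc_tree_odd:
  assumes \<eta>: "\<eta> \<in> \<Omega>" "\<alpha> \<in> \<eta>" and e: "e \<in> E1" "st e = state \<eta> \<alpha>"
    and red: "reduced ((e, True) # lift \<eta> \<alpha>)"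
  shows "lc (tree \<eta>) ((e, True) # lift \<eta> \<alpha>) =
    {(e, False)} \<union> {(ed (state \<eta> (cons_red \<sigma> \<alpha>)) [letinv \<sigma>], False) |\<sigma>. lt e = [\<sigma>]}"
    (is "?L = ?R")
proof (intro equalityI subsetI)
  fix x
  assume "x \<in> ?R"
  then consider "x = (e, False)"
    | \<sigma> where "lt e = [\<sigma>]" "x = (ed (state \<eta> (cons_red \<sigma> \<alpha>)) [letinv \<sigma>], False)"
    by blast
  then show "x \<in> ?L"
  proof cases
    case 1
    then show ?thesis
      using e lift_tree[OF \<eta>(2)] by (simp add: mem_local_config cons_red_def)
  next
    case 2
    then have "[\<sigma>] \<in> state \<eta> \<alpha>" using edge e by metis
    then have c: "cons_red \<sigma> \<alpha> \<in> \<eta>" using \<eta> by (simp add: letter_state)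
    have "ed (state \<eta> \<alpha>) [\<sigma>] = e" using edge[OF e(1)] e 2 by simp
    then have "lift \<eta> (cons_red \<sigma> \<alpha>) = cons_red x ((e, True) # lift \<eta> \<alpha>)"
      using lift_cons_red[OF \<eta> c] red 2 by (simp add: cons_red_reduced)
    then show ?thesis
      using lift_tree[OF c] edge_state'(1)[OF \<eta> c] 2 by (simp add: mem_local_config)
  qed
next
  fix x
  assume "x \<in> ?L"
  then have x: "fst x \<in> E1" "cons_red x ((e, True) # lift \<eta> \<alpha>) \<in> tree \<eta>"
    by (auto simp: mem_local_config)
  show "x \<in> ?R"
  proof (cases "reduced (x # (e, True) # lift \<eta> \<alpha>)")
    case True
    then have "x # (e, True) # lift \<eta> \<alpha> \<in> tree \<eta>"
      using x(2) by (simp add: cons_red_reduced)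
    then obtain \<beta> where b: "\<beta> \<in> \<eta>" "x # (e, True) # lift \<eta> \<alpha> = lift \<eta> \<beta>"
      using tree_lift_parity[OF \<eta>(1), of "x # (e, True) # lift \<eta> \<alpha>"] length_lift[OF \<eta>] by auto
    then obtain \<sigma> \<gamma> where s: "\<beta> = \<sigma> # \<gamma>" by (cases \<beta>) auto
    then have g: "\<gamma> \<in> \<eta>" "cons_red \<sigma> \<gamma> = \<beta>"
      using b \<eta> Omega_convex right_convex_Cons cons_red_reduced Omega_reduced by metis+
    have l: "x = (ed (state \<eta> \<beta>) [letinv \<sigma>], False)" "e = ed (state \<eta> \<gamma>) [\<sigma>]" "lift \<eta> \<alpha> = lift \<eta> \<gamma>"
      using lift_Cons[of \<eta> \<sigma> \<gamma>] b s \<eta> by auto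
    then have "\<alpha> = \<gamma>" using lift_inj \<eta> g by blast
    then have "lt e = [\<sigma>]" "x = (ed (state \<eta> (cons_red \<sigma> \<alpha>)) [letinv \<sigma>], False)"
      using l g edge_state(3)[of \<eta> \<gamma> \<sigma>] \<eta> b by simp_all
    then show ?thesis by blast
  next
    case False
    then have "(e, True) = letinv x" using red by simp
    then have "x = (e, False)" by (cases x) auto
    then show ?thesis by blast
  qed
qed

lemma tree_graph_shift:
  assumes \<eta>: "\<eta> \<in> \<Omega>"
  shows "tree \<eta> \<in> graph_shift"
proof -
  have "tree \<eta> \<subseteq> FG E1"
    using \<eta> by (auto simp: tree_def lift_FG FG_cons_red)
  moreover have "[] \<in> tree \<eta>"
    using lift_tree[OF Omega_Nil[OF \<eta>]] by simp
  moreover have "right_convex (tree \<eta>)"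
  proof (rule right_convexI)
    fix x g
    assume x: "x # g \<in> tree \<eta>"
    with \<eta> show "g \<in> tree \<eta>"
    proof (cases rule: tree_cases)
      case (even \<alpha>)
      then obtain \<sigma> \<beta> where a: "\<alpha> = \<sigma> # \<beta>" by (cases \<alpha>) auto
      have b: "\<beta> \<in> \<eta>" "cons_red \<sigma> \<beta> \<in> \<eta>"
        using a even \<eta> Omega_convex right_convex_Cons cons_red_reduced Omega_reduced by metis+
      have g: "g = (ed (state \<eta> \<beta>) [\<sigma>], True) # lift \<eta> \<beta>"
        using lift_Cons[of \<eta> \<sigma> \<beta>] even a \<eta> by simp
      have "reduced g" using even reduced_lift[of \<eta> \<alpha>] by (metis reduced_Cons)
      then show ?thesis
        using g tree_outI[OF b(1) edge_state(1,2)[OF \<eta> b]] by (simp add: cons_red_reduced)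
    next
      case (odd \<alpha> e)
      then show ?thesis by (simp add: lift_tree)
    qed
  qed
  moreover have "(\<exists>B\<in>\<G>. lc (tree \<eta>) g = out B) \<or>
       (\<exists>e\<in>E1. lt e = [] \<and> lc (tree \<eta>) g = {(e, False)}) \<or>
       (\<exists>e\<in>E1. \<exists>e'\<in>E1. match e e' \<and> lc (tree \<eta>) g = {(e, False), (e', False)})"
    if g: "g \<in> tree \<eta>" for g
    using \<eta> g
  proof (cases rule: tree_cases)
    case (even \<alpha>)
    then show ?thesis using lc_tree_lift state_ball \<eta> by blast
  next
    case (odd \<alpha> e)
    note L = lc_tree_odd[OF \<eta> odd(1-3), folded odd(4), OF odd(5)]
    have len: "length (lt e) \<le> 1" using edge odd by blast
    show ?thesis
    proof (cases "lt e")
      case Nil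
      then show ?thesis using L odd by auto
    next
      case (Cons \<sigma> u)
      then have s: "lt e = [\<sigma>]" using len by simp
      then have "[\<sigma>] \<in> state \<eta> \<alpha>" using edge odd by metis
      then have c: "cons_red \<sigma> \<alpha> \<in> \<eta>" using \<eta> odd by (simp add: letter_state)
      have "ed (state \<eta> \<alpha>) [\<sigma>] = e" using edge[OF odd(2)] odd s by simp
      then have "match e (ed (state \<eta> (cons_red \<sigma> \<alpha>)) [letinv \<sigma>])"
        using match_state[OF \<eta> odd(1) c] by simp
      moreover have "lc (tree \<eta>) g = {(e, False), (ed (state \<eta> (cons_red \<sigma> \<alpha>)) [letinv \<sigma>], False)}"
        unfolding L s by blast
      ultimately show ?thesis
        using edge_state'(1)[OF \<eta> odd(1) c] odd(2) by blast
    qed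
  qed
  ultimately show ?thesis by (simp add: graph_shift_def)
qed

section \<open>Every configuration at a ball is a lift\<close>

text \<open>As every ball emits an edge, these are the configurations whose vertex at 1 is a ball,
  described by finitely many bits.\<close>

definition ball_points :: "'e word set set" where
  "ball_points = {\<xi> \<in> graph_shift. \<exists>e\<in>E1. [(e, True)] \<in> \<xi>}"

lemma ball_points_iff: "\<xi> \<in> ball_points \<longleftrightarrow> \<xi> \<in> graph_shift \<and> (\<exists>e. (e, True) \<in> lc \<xi> [])"
  by (auto simp: ball_points_def mem_local_config cons_red_def)

text \<open>Even a ball without letters can be recovered from its edges, namely from the dead end
  \<open>ed B []\<close>.\<close>

lemma out_inj: "B \<in> \<G> \<Longrightarrow> out B = out B' \<Longrightarrow> B = B'"
proof -
  assume B: "B \<in> \<G>" "out B = out B'"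
  have e: "ed B [] \<in> E1" "st (ed B []) = B" using ed[of B "[]"] ball_Nil B(1) by auto
  then have "(ed B [], True) \<in> out B'" unfolding B(2)[symmetric] by (auto simp: out_def)
  then show "B = B'" using e by (auto simp: out_def)
qed

lemma lc_back:
  "\<xi> \<in> graph_shift \<Longrightarrow> g \<in> \<xi> \<Longrightarrow> fst x \<in> E1 \<Longrightarrow> letinv x \<in> lc \<xi> (cons_red x g)"
  by (simp add: mem_local_config cons_red_letinv graph_shift_reduced)

lemma lc_back_out:
  "\<xi> \<in> graph_shift \<Longrightarrow> g \<in> \<xi> \<Longrightarrow> e \<in> E1 \<Longrightarrow> (e, False) \<in> lc \<xi> (cons_red (e, True) g)"
  "\<xi> \<in> graph_shift \<Longrightarrow> g \<in> \<xi> \<Longrightarrow> e \<in> E1 \<Longrightarrow> (e, True) \<in> lc \<xi> (cons_red (e, False) g)"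
  using lc_back[of \<xi> g "(e, True)"] lc_back[of \<xi> g "(e, False)"] by simp_all

lemma lc_cases:
  assumes "\<xi> \<in> graph_shift" "g \<in> \<xi>"
  obtains B where "B \<in> \<G>" "lc \<xi> g = out B"
  | e where "e \<in> E1" "lt e = []" "lc \<xi> g = {(e, False)}"
  | e e' where "e \<in> E1" "e' \<in> E1" "match e e'" "lc \<xi> g = {(e, False), (e', False)}"
  using assms unfolding graph_shift_def by blast

text \<open>Only balls have outgoing edges, so a single one identifies the vertex.\<close>

lemma lc_True:
  assumes "\<xi> \<in> graph_shift" "g \<in> \<xi>" "(e, True) \<in> lc \<xi> g"
  shows "lc \<xi> g = out (st e)" "st e \<in> \<G>" "e \<in> E1"
  using assms(3) by (cases rule: lc_cases[OF assms(1,2)]; auto simp: out_def)+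

lemma lc_False:
  assumes "\<xi> \<in> graph_shift" "g \<in> \<xi>" "(e, False) \<in> lc \<xi> g" "lt e = [\<sigma>]"
  obtains e' where "e' \<in> E1" "match e e'" "lc \<xi> g = {(e, False), (e', False)}"
proof (cases rule: lc_cases[OF assms(1,2)])
  case (1 B)
  then show ?thesis using assms by (auto simp: out_def)
next
  case (2 f)
  then show ?thesis using assms by auto
next
  case (3 f f')
  then consider "e = f" | "e = f'" using assms by auto
  then show ?thesis
  proof cases
    case 1
    then show ?thesis using that 3 by blast
  next
    case 2
    then show ?thesis using that[of f] 3 match_sym by (metis insert_commute)
  qed
qed

lemma lc_False_Nil:
  assumes "\<xi> \<in> graph_shift" "g \<in> \<xi>" "(e, False) \<in> lc \<xi> g" "lt e = []"
  shows "lc \<xi> g = {(e, False)}"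
  using assms(3,4) by (cases rule: lc_cases[OF assms(1,2)]) (auto simp: out_def match_def)

text \<open>\<open>walk \<xi> \<alpha> g B\<close>: reading off the letters of \<open>\<alpha>\<close> one after the other, the configuration \<open>\<xi>\<close> leads from
  1 to its point \<open>g\<close>, whose vertex is the ball \<open>B\<close>.\<close>

inductive walk :: "'e word set \<Rightarrow> 'a word \<Rightarrow> 'e word \<Rightarrow> 'a word set \<Rightarrow> bool" for \<xi> where
  start: "lc \<xi> [] = out B \<Longrightarrow> B \<in> \<G> \<Longrightarrow> walk \<xi> [] [] B"
| step: "walk \<xi> \<alpha> g B \<Longrightarrow> reduced (\<sigma> # \<alpha>) \<Longrightarrow> e \<in> E1 \<Longrightarrow> st e = B \<Longrightarrow> lt e = [\<sigma>] \<Longrightarrow>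
    e' \<in> E1 \<Longrightarrow> match e e' \<Longrightarrow> (e', False) \<in> lc \<xi> (cons_red (e, True) g) \<Longrightarrow>
    walk \<xi> (\<sigma> # \<alpha>) (cons_red (e', False) (cons_red (e, True) g)) (st e')"

inductive_cases walk_NilE: "walk \<xi> [] g B"
inductive_cases walk_ConsE: "walk \<xi> (\<sigma> # \<alpha>) g B"

lemma walk_props:
  assumes \<xi>: "\<xi> \<in> graph_shift" and "walk \<xi> \<alpha> g B"
  shows "g \<in> \<xi> \<and> lc \<xi> g = out B \<and> B \<in> \<G> \<and> \<alpha> \<in> FG A"
  using assms(2)
proof induction
  case (start B)
  then show ?case using \<xi> by (auto simp: graph_shift_def)
next
  case (step \<alpha> g B \<sigma> e e')
  have m: "cons_red (e, True) g \<in> \<xi>"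
    using step by (auto simp: out_def mem_local_config)
  have g2: "cons_red (e', False) (cons_red (e, True) g) \<in> \<xi>"
    using step by (auto simp: mem_local_config)
  have "fst \<sigma> \<in> A"
    using edge[OF step(3)] ball_Conv[of "st e"] step(5) by (auto simp: Conv_def FG_def)
  then show ?case
    using g2 lc_True[OF \<xi> g2 lc_back_out(2)[OF \<xi> m]] step by (simp add: FG_Cons)
qed

lemma walk_mid:
  assumes \<xi>: "\<xi> \<in> graph_shift" and w: "walk \<xi> \<alpha> g B" and e: "e \<in> E1" "st e = B"
  shows "cons_red (e, True) g \<in> \<xi>" "(e, False) \<in> lc \<xi> (cons_red (e, True) g)"
proof -
  have g: "g \<in> \<xi>" "lc \<xi> g = out B" using walk_props[OF \<xi> w] by auto
  then show "cons_red (e, True) g \<in> \<xi>"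
    using e by (auto simp: out_def mem_local_config set_eq_iff)
  show "(e, False) \<in> lc \<xi> (cons_red (e, True) g)" using lc_back_out(1)[OF \<xi> g(1) e(1)] .
qed

text \<open>The local configuration at a midpoint has just two elements and \<open>match\<close> is
  irreflexive, so a partner of \<open>e\<close> is the other element.\<close>

lemma walk_match_unique:
  assumes \<xi>: "\<xi> \<in> graph_shift" and m: "m \<in> \<xi>"
    and "(e, False) \<in> lc \<xi> m" "(e1, False) \<in> lc \<xi> m" "(e2, False) \<in> lc \<xi> m"
    and "match e e1" "match e e2"
  shows "e1 = e2"
proof -
  obtain \<sigma> where "lt e = [\<sigma>]" using assms(6) by (auto simp: match_def)
  then obtain e' where "lc \<xi> m = {(e, False), (e', False)}"
    using lc_False[OF \<xi> m assms(3)] by metis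
  then show ?thesis using assms match_neq by auto
qed

text \<open>A ball and a letter determine the outgoing edge; the local configuration at the midpoint
  then determines the edge into the next ball.\<close>

lemma walk_det:
  assumes \<xi>: "\<xi> \<in> graph_shift"
  shows "walk \<xi> \<alpha> g B \<Longrightarrow> walk \<xi> \<alpha> g' B' \<Longrightarrow> g = g' \<and> B = B'"
proof (induction \<alpha> arbitrary: g B g' B')
  case Nil
  then show ?case by (metis out_inj walk_NilE)
next
  case (Cons \<sigma> \<alpha>)
  from Cons.prems(1) obtain h C e e' where 1: "walk \<xi> \<alpha> h C" "e \<in> E1" "st e = C" "lt e = [\<sigma>]"
    "match e e'" "(e', False) \<in> lc \<xi> (cons_red (e, True) h)"
    "g = cons_red (e', False) (cons_red (e, True) h)" "B = st e'"
    by (auto elim: walk_ConsE)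
  from Cons.prems(2) obtain h1 C1 e1 e1' where 2: "walk \<xi> \<alpha> h1 C1" "e1 \<in> E1" "st e1 = C1" "lt e1 = [\<sigma>]"
    "match e1 e1'" "(e1', False) \<in> lc \<xi> (cons_red (e1, True) h1)"
    "g' = cons_red (e1', False) (cons_red (e1, True) h1)" "B' = st e1'"
    by (auto elim: walk_ConsE)
  have h: "h = h1" "C = C1" using Cons.IH 1 2 by blast+
  then have e: "e = e1" using edge_eqI 1 2 by simp
  have "e' = e1'"
    using walk_match_unique[OF \<xi> walk_mid[OF \<xi> 1(1-3)]] 1 2 h e by simp
  then show ?case using 1 2 h e by simp
qed

text \<open>In contrast to \<open>walk.step\<close>, the letter may cancel here, in which case the walk goes back.\<close>

lemma walk_step:
  assumes \<xi>: "\<xi> \<in> graph_shift" and w: "walk \<xi> \<alpha> g B"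
    and e: "e \<in> E1" "st e = B" "lt e = [\<sigma>]"
    and e': "e' \<in> E1" "match e e'" "(e', False) \<in> lc \<xi> (cons_red (e, True) g)"
  shows "walk \<xi> (cons_red \<sigma> \<alpha>) (cons_red (e', False) (cons_red (e, True) g)) (st e')"
proof (cases "reduced (\<sigma> # \<alpha>)")
  case True
  then show ?thesis using walk.step[OF w True e e'] by (simp add: cons_red_reduced)
next
  case False
  have "reduced \<alpha>" using walk_props[OF \<xi> w] FG_reduced by blast
  then have a: "\<alpha> = letinv \<sigma> # cons_red \<sigma> \<alpha>" using cons_red_not_reduced False by blast
  define \<beta> where "\<beta> = cons_red \<sigma> \<alpha>"
  have "walk \<xi> (letinv \<sigma> # \<beta>) g B" using w a \<beta>_def by simp
  then obtain h f f' where f: "walk \<xi> \<beta> h (st f)" "f \<in> E1" "lt f = [letinv \<sigma>]"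
    "f' \<in> E1" "match f f'" "(f', False) \<in> lc \<xi> (cons_red (f, True) h)"
    "g = cons_red (f', False) (cons_red (f, True) h)" "B = st f'"
    by (auto elim: walk_ConsE)
  have h: "h \<in> \<xi>" "reduced h" using walk_props[OF \<xi> f(1)] graph_shift_reduced \<xi> by auto
  \<comment> \<open>The walk reached \<open>g\<close> across \<open>letinv \<sigma>\<close> and
    entered \<open>B\<close> by \<open>f'\<close>, which carries \<open>\<sigma>\<close>. Leaving by
    \<open>e\<close> therefore retraces it, and by uniqueness the partner of \<open>e\<close> is
    \<open>f\<close>.\<close>
  have "e = f'" using edge_eqI e f match_lt[OF f(5,3)] by simp
  then have m: "cons_red (e, True) g = cons_red (f, True) h"
    using f(7) h cons_red_letinv[of "cons_red (f, True) h" "(f', False)"] by (simp add: reduced_cons_red)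
  have "e' = f"
    using walk_match_unique[OF \<xi> walk_mid[OF \<xi> w e(1,2)], of e' f] e' m
      walk_mid(2)[OF \<xi> f(1,2) refl] match_sym[OF f(5)] \<open>e = f'\<close> by simp
  then show ?thesis
    using f(1) m h cons_red_letinv[of h "(f, True)"] \<beta>_def by simp
qed

lemma walk_ex:
  assumes \<xi>: "\<xi> \<in> graph_shift" and w: "walk \<xi> \<alpha> g B" and s: "[\<sigma>] \<in> B"
  obtains e e' where "e \<in> E1" "st e = B" "lt e = [\<sigma>]" "match e e'"
    "walk \<xi> (cons_red \<sigma> \<alpha>) (cons_red (e', False) (cons_red (e, True) g)) (st e')"
proof -
  have "B \<in> \<G>" using walk_props[OF \<xi> w] by simp
  then have e: "ed B [\<sigma>] \<in> E1" "st (ed B [\<sigma>]) = B" "lt (ed B [\<sigma>]) = [\<sigma>]"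
    using ed s by auto
  obtain e' where e': "e' \<in> E1" "match (ed B [\<sigma>]) e'"
    "(e', False) \<in> lc \<xi> (cons_red (ed B [\<sigma>], True) g)"
    using lc_False[OF \<xi> walk_mid[OF \<xi> w e(1,2)] e(3)] by (metis insertCI)
  show thesis using that[OF e e'(2) walk_step[OF \<xi> w e e']] .
qed

text \<open>Walks are used here because it is not yet known that they reach every point of even
  length. Once this is shown for \<open>ball_points\<close>, \<open>descend\<close> gives the same
  set.\<close>

definition base :: "'e word set \<Rightarrow> 'a word set" where
  "base \<xi> = {\<alpha>. \<exists>g B. walk \<xi> \<alpha> g B}"

lemma base_Conv:
  assumes \<xi>: "\<xi> \<in> ball_points"
  shows "base \<xi> \<in> Conv A"
proof -
  have \<xi>': "\<xi> \<in> graph_shift" and n: "[] \<in> \<xi>" using \<xi> by (auto simp: ball_points_def graph_shift_def)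
  obtain e where "(e, True) \<in> lc \<xi> []" using \<xi> by (auto simp: ball_points_iff)
  then have "walk \<xi> [] [] (st e)"
    using lc_True[OF \<xi>' n] walk.start by blast
  moreover have "\<exists>g B. walk \<xi> \<alpha> g B" if "walk \<xi> (\<sigma> # \<alpha>) g B" for \<sigma> \<alpha> g B
    using that by (rule walk_ConsE) blast
  then have "right_convex (base \<xi>)"
    unfolding base_def by (intro right_convexI) blast
  ultimately show ?thesis
    using walk_props[OF \<xi>'] unfolding Conv_def base_def by blast
qed

text \<open>Either the walk to \<open>\<sigma> # \<alpha>\<close> leaves \<open>B\<close> by an edge
  labelled \<open>\<sigma>\<close>, or the walk to \<open>\<alpha>\<close> has just crossed
  \<open>letinv \<sigma>\<close> and entered \<open>B\<close> by such an edge.\<close>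

lemma walk_letter:
  assumes \<xi>: "\<xi> \<in> graph_shift" and w: "walk \<xi> \<alpha> g B" and s: "cons_red \<sigma> \<alpha> \<in> base \<xi>"
  shows "[\<sigma>] \<in> B"
proof (cases "reduced (\<sigma> # \<alpha>)")
  case True
  then obtain g' B' where "walk \<xi> (\<sigma> # \<alpha>) g' B'" using s by (auto simp: base_def cons_red_reduced)
  then obtain h e where "walk \<xi> \<alpha> h (st e)" "e \<in> E1" "lt e = [\<sigma>]" by (auto elim: walk_ConsE)
  then show ?thesis using walk_det[OF \<xi> w] edge by metis
next
  case False
  have "reduced \<alpha>" using walk_props[OF \<xi> w] FG_reduced by blast
  then have "\<alpha> = letinv \<sigma> # cons_red \<sigma> \<alpha>" using cons_red_not_reduced False by blast
  then have "walk \<xi> (letinv \<sigma> # cons_red \<sigma> \<alpha>) g B" using w by simp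
  then obtain e e' where "e' \<in> E1" "match e e'" "lt e = [letinv \<sigma>]" "B = st e'"
    by (auto elim: walk_ConsE)
  then show ?thesis using match_lt[of e e' "letinv \<sigma>"] edge[of e'] by simp
qed

text \<open>The induction peels off the rightmost letter, the one nearest to the centre, and passes
  the shorter word to the matched ball one step away. Thus agreement on overlaps propagates to whole
  balls and glues the local data into one convex set.\<close>

lemma walk_ball:
  assumes \<xi>: "\<xi> \<in> ball_points"
  shows "walk \<xi> \<alpha> g B \<Longrightarrow> reduced w \<Longrightarrow> length w \<le> N \<Longrightarrow> w \<in> B \<longleftrightarrow> wmult w \<alpha> \<in> base \<xi>"
proof (induction w arbitrary: \<alpha> g B rule: rev_induct)
  case Nil
  then show ?case
    using walk_props[of \<xi>] \<xi> ball_Nil by (auto simp: base_def ball_points_def)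
next
  case (snoc \<sigma> w)
  have \<xi>': "\<xi> \<in> graph_shift" using \<xi> by (simp add: ball_points_def)
  have B: "B \<in> \<G>" and ra: "reduced \<alpha>" using walk_props[OF \<xi>' snoc.prems(1)] FG_reduced by auto
  have r: "reduced w" "wmult w [\<sigma>] = w @ [\<sigma>]" "wmult (w @ [\<sigma>]) \<alpha> = wmult w (cons_red \<sigma> \<alpha>)"
    using snoc.prems(2) reduced_append wmult_reduced_append by (auto simp: wmult_append)
  have a: "\<alpha> \<in> base \<xi>" using snoc.prems(1) by (auto simp: base_def)
  have iff: "w @ [\<sigma>] \<in> B \<longleftrightarrow> wmult w (cons_red \<sigma> \<alpha>) \<in> base \<xi>" if "[\<sigma>] \<in> B"
  proof -
    obtain e e' where e: "st e = B" "lt e = [\<sigma>]" "match e e'"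
      "walk \<xi> (cons_red \<sigma> \<alpha>) (cons_red (e', False) (cons_red (e, True) g)) (st e')"
      using walk_ex[OF \<xi>' snoc.prems(1) \<open>[\<sigma>] \<in> B\<close>] by metis
    have "w \<in> st e' \<longleftrightarrow> wmult w (cons_red \<sigma> \<alpha>) \<in> base \<xi>"
      using snoc.IH[OF e(4)] snoc.prems r by simp
    \<comment> \<open>Both \<open>w\<close> and \<open>w @ [\<sigma>]\<close> have length at most
      \<open>N\<close>, so they lie in the region that \<open>match\<close> compares.\<close>
    moreover have "w \<in> st e' \<longleftrightarrow> w @ [\<sigma>] \<in> B"
      using match_mem[OF e(3,2), of w] snoc.prems r e(1) by simp
    ultimately show ?thesis by simp
  qed
  have "[\<sigma>] \<in> B" if "w @ [\<sigma>] \<in> B" using B that by (rule ball_last)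
  \<comment> \<open>Convexity of the translate puts the first step towards
    \<open>w @ [\<sigma>]\<close> into it as well.\<close>
  moreover have "[\<sigma>] \<in> B" if m: "wmult w (cons_red \<sigma> \<alpha>) \<in> base \<xi>"
  proof -
    have red: "\<And>v. v \<in> base \<xi> \<Longrightarrow> reduced v" using base_Conv[OF \<xi>] Conv_reduced by blast
    have "w @ [\<sigma>] \<in> shift_act \<alpha> (base \<xi>)"
      using mem_shift_act[OF red ra] snoc.prems m r by simp
    then have "[\<sigma>] \<in> shift_act \<alpha> (base \<xi>)"
      using shift_act_Conv[OF base_Conv[OF \<xi>] a] right_convex_append[of "shift_act \<alpha> (base \<xi>)"]
      by (auto simp: Conv_def)
    then have "cons_red \<sigma> \<alpha> \<in> base \<xi>" using mem_shift_act[OF red ra] by simp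
    then show ?thesis using walk_letter[OF \<xi>' snoc.prems(1)] by simp
  qed
  ultimately show ?case using iff r by auto
qed

lemma walk_state:
  assumes \<xi>: "\<xi> \<in> ball_points" and w: "walk \<xi> \<alpha> g B"
  shows "state (base \<xi>) \<alpha> = B"
proof -
  have a: "\<alpha> \<in> base \<xi>" using w by (auto simp: base_def)
  have B: "B \<in> \<G>" using walk_props[OF _ w] \<xi> by (auto simp: ball_points_def)
  show ?thesis
    using mem_state[OF base_Conv[OF \<xi>] a] walk_ball[OF \<xi> w] ball_reduced[OF B] ball_length[OF B]
    by blast
qed

text \<open>Here finite type enters: membership in \<Omega> is tested ball by ball, and every ball
  of \<open>base \<xi>\<close> is a vertex met on a walk.\<close>

lemma base_Omega:
  assumes \<xi>: "\<xi> \<in> ball_points"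
  shows "base \<xi> \<in> \<Omega>"
  unfolding Omega_iff
proof (intro conjI ballI)
  show "base \<xi> \<in> Conv A" using \<xi> by (rule base_Conv)
  fix \<alpha>
  assume "\<alpha> \<in> base \<xi>"
  then obtain g B where w: "walk \<xi> \<alpha> g B" by (auto simp: base_def)
  then have "B \<in> \<G>" using walk_props[OF _ w] \<xi> by (auto simp: ball_points_def)
  then show "trunc N (shift_act \<alpha> (base \<xi>)) \<in> \<G>"
    using walk_state[OF \<xi> w] by (simp add: state_def)
qed

lemma walk_lift:
  assumes \<xi>: "\<xi> \<in> ball_points"
  shows "walk \<xi> \<alpha> g B \<Longrightarrow> g = lift (base \<xi>) \<alpha>"
proof (induction \<alpha> g B rule: walk.induct)
  case (start B)
  then show ?case by simp
next
  case (step \<alpha> g B \<sigma> e e')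
  have "state (base \<xi>) \<alpha> = B" "state (base \<xi>) (\<sigma> # \<alpha>) = st e'"
    using walk_state[OF \<xi> step(1)] walk_state[OF \<xi> walk.step[OF step(1-8)]] by simp_all
  moreover have "ed B [\<sigma>] = e" "ed (st e') [letinv \<sigma>] = e'"
    using edge[of e] edge[of e'] step match_lt[of e e' \<sigma>] by auto
  ultimately show ?case using step by simp
qed

text \<open>Induction along the words of \<open>\<xi>\<close>: at a point already known to lie in
  the tree, the walk fixes the local configuration, which leaves no room for a further
  point.\<close>

lemma ball_points_tree:
  assumes \<xi>: "\<xi> \<in> ball_points"
  shows "\<xi> = tree (base \<xi>)"
proof (intro equalityI subsetI)
  have \<xi>': "\<xi> \<in> graph_shift" using \<xi> by (simp add: ball_points_def)
  note \<eta> = base_Omega[OF \<xi>]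
  have W: "walk \<xi> \<alpha> (lift (base \<xi>) \<alpha>) (state (base \<xi>) \<alpha>)" if "\<alpha> \<in> base \<xi>" for \<alpha>
    using that walk_lift[OF \<xi>] walk_state[OF \<xi>] by (auto simp: base_def)
  fix g
  show "g \<in> \<xi>" if "g \<in> tree (base \<xi>)"
    using that walk_props[OF \<xi>' W] walk_mid(1)[OF \<xi>' W] by (auto simp: tree_def)
  show "g \<in> tree (base \<xi>)" if "g \<in> \<xi>"
    using that
  proof (induction g)
    case Nil
    then show ?case using lift_tree[OF Omega_Nil[OF \<eta>]] by simp
  next
    case (Cons x g)
    have g: "g \<in> \<xi>" using Cons.prems \<xi>' right_convex_Cons unfolding graph_shift_def by blast
    have xg: "x # g \<in> FG E1" using Cons.prems \<xi>' by (auto simp: graph_shift_def)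
    then have cx: "cons_red x g = x # g" using FG_reduced cons_red_reduced by blast
    then have x: "x \<in> lc \<xi> g" using Cons.prems xg by (simp add: mem_local_config FG_Cons)
    from \<eta> Cons.IH[OF g] show ?case
    proof (cases rule: tree_cases)
      case (even \<alpha>)
      then have "x \<in> out (state (base \<xi>) \<alpha>)" using x walk_props[OF \<xi>' W] by simp
      then obtain e where "x = (e, True)" "e \<in> E1" "st e = state (base \<xi>) \<alpha>" by (auto simp: out_def)
      then show ?thesis using tree_outI[OF even(1)] even(2) cx by metis
    next
      case (odd \<alpha> e)
      have g': "g = cons_red (e, True) (lift (base \<xi>) \<alpha>)" using odd by (simp add: cons_red_reduced)
      have eF: "(e, False) \<in> lc \<xi> g"
        using walk_mid(2)[OF \<xi>' W[OF odd(1)] odd(2,3)] g' by simp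
      \<comment> \<open>Going back along \<open>e\<close> is excluded because \<open>x # g\<close>
        is reduced. Hence \<open>e\<close> is not a dead end, where going back is the only
        continuation.\<close>
      have xe: "x \<noteq> (e, False)" using xg odd(4) by (auto simp: FG_def)
      have "lt e \<noteq> []" using lc_False_Nil[OF \<xi>' g eF] x xe by auto
      then obtain \<sigma> where s: "lt e = [\<sigma>]" using edge[OF odd(2)] by (cases "lt e") auto
      obtain e' where e': "e' \<in> E1" "match e e'" "lc \<xi> g = {(e, False), (e', False)}"
        using lc_False[OF \<xi>' g eF s] by metis
      then have x': "x = (e', False)" using x xe by auto
      have "walk \<xi> (cons_red \<sigma> \<alpha>) (x # g) (st e')"
        using walk_step[OF \<xi>' W[OF odd(1)] odd(2,3) s e'(1,2)] e'(3) x' g' cx by simp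
      then have "cons_red \<sigma> \<alpha> \<in> base \<xi>" "x # g = lift (base \<xi>) (cons_red \<sigma> \<alpha>)"
        using walk_lift[OF \<xi>] by (auto simp: base_def)
      then show ?thesis using lift_tree by metis
    qed
  qed
qed

section \<open>The Kakutani equivalence\<close>

text \<open>An explicit form of the projection, from which equivariance and local dependence can be
  read off more easily than from walks.\<close>

definition descend :: "'e word set \<Rightarrow> 'a word set" where
  "descend \<xi> = proj ` {g \<in> \<xi>. even (length g)}"

lemma descend_tree:
  assumes "\<eta> \<in> \<Omega>"
  shows "descend (tree \<eta>) = \<eta>"
proof -
  have "{g \<in> tree \<eta>. even (length g)} = lift \<eta> ` \<eta>"
    using tree_lift_parity assms lift_tree length_lift by fastforce
  then show ?thesis
    using proj_lift assms by (simp add: descend_def image_image)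
qed

lemma tree_ball_points:
  assumes \<eta>: "\<eta> \<in> \<Omega>"
  shows "tree \<eta> \<in> ball_points"
proof -
  have "(ed (state \<eta> []) [], True) \<in> lc (tree \<eta>) []"
    using lc_tree_lift[OF \<eta> Omega_Nil[OF \<eta>]] ed[of "state \<eta> []" "[]"] state_ball[OF \<eta> Omega_Nil[OF \<eta>]]
      ball_Nil by (simp add: out_def)
  then show ?thesis using tree_graph_shift[OF \<eta>] by (auto simp: ball_points_iff)
qed

lemma descend_ball_points:
  assumes "\<xi> \<in> ball_points"
  shows "descend \<xi> \<in> \<Omega>" "tree (descend \<xi>) = \<xi>"
  using ball_points_tree[OF assms] base_Omega[OF assms] descend_tree by metis+

text \<open>Translation by an element of even length preserves parity, and \<open>proj\<close> is a
  homomorphism.\<close>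

lemma descend_shift_act:
  assumes \<xi>: "\<xi> \<in> graph_shift" and g: "g \<in> \<xi>" "even (length g)"
  shows "descend (shift_act g \<xi>) = shift_act (proj g) (descend \<xi>)"
proof -
  have "{h \<in> shift_act g \<xi>. even (length h)} = (\<lambda>h. wmult h (winv g)) ` {h \<in> \<xi>. even (length h)}"
    using g(2) by (auto simp: shift_act_def even_length_wmult)
  then show ?thesis
    unfolding descend_def shift_act_def
    by (simp add: image_image proj_wmult proj_winv[OF graph_shift_reduced[OF \<xi> g(1)]])
qed

abbreviation graph_arrows :: "('e word \<times> 'e word set) set" where
  "graph_arrows \<equiv> ta_arrows (FG E1) (shift_dom graph_shift) shift_act ball_points"

abbreviation base_arrows :: "('a word \<times> 'a word set) set" where
  "base_arrows \<equiv> ta_arrows (FG A) (shift_dom \<Omega>) shift_act \<Omega>"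

lemma base_arrows_iff: "(\<alpha>, \<eta>) \<in> base_arrows \<longleftrightarrow> \<eta> \<in> \<Omega> \<and> \<alpha> \<in> \<eta>"
  using Omega_shift Omega_Conv by (auto simp: ta_arrows_def shift_dom_def Conv_def)

lemma shift_act_ball_points:
  assumes \<xi>: "\<xi> \<in> graph_shift" and g: "g \<in> \<xi>"
  shows "shift_act g \<xi> \<in> ball_points \<longleftrightarrow> (\<exists>e. (e, True) \<in> lc \<xi> g)"
  using graph_shift_shift_act[OF \<xi> g]
    local_config_shift_act[OF graph_shift_reduced[OF \<xi>] graph_shift_reduced[OF \<xi> g], where h = "[]" and E = E1]
  by (simp add: ball_points_iff)

text \<open>An arrow of the restriction has to end at a ball again. Points of odd length are ranges,
  so exactly the lifts remain.\<close>

lemma graph_arrows_iff: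
  "(g, \<xi>) \<in> graph_arrows \<longleftrightarrow> (\<exists>\<eta>\<in>\<Omega>. \<exists>\<alpha>\<in>\<eta>. g = lift \<eta> \<alpha> \<and> \<xi> = tree \<eta>)"
proof
  assume a: "(g, \<xi>) \<in> graph_arrows"
  then have \<xi>: "\<xi> \<in> ball_points" "\<xi> \<in> graph_shift" and g: "g \<in> \<xi>" "shift_act g \<xi> \<in> ball_points"
    by (auto simp: ta_arrows_def shift_dom_def)
  define \<eta> where "\<eta> = descend \<xi>"
  have \<eta>: "\<eta> \<in> \<Omega>" "\<xi> = tree \<eta>" using descend_ball_points[OF \<xi>(1)] by (simp_all add: \<eta>_def)
  obtain e where e: "(e, True) \<in> lc (tree \<eta>) g"
    using shift_act_ball_points[OF \<xi>(2) g(1)] g(2) \<eta> by auto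
  have "g \<in> tree \<eta>" using g \<eta> by simp
  with \<eta>(1) have "\<exists>\<alpha>\<in>\<eta>. g = lift \<eta> \<alpha>"
  proof (cases rule: tree_cases)
    case (odd \<alpha> f)
    then show ?thesis
      using lc_tree_odd[OF \<eta>(1) odd(1-3)] e by auto
  qed auto
  then show "\<exists>\<eta>\<in>\<Omega>. \<exists>\<alpha>\<in>\<eta>. g = lift \<eta> \<alpha> \<and> \<xi> = tree \<eta>" using \<eta> by auto
next
  assume "\<exists>\<eta>\<in>\<Omega>. \<exists>\<alpha>\<in>\<eta>. g = lift \<eta> \<alpha> \<and> \<xi> = tree \<eta>"
  then obtain \<eta> \<alpha> where \<eta>: "\<eta> \<in> \<Omega>" "\<alpha> \<in> \<eta>" "g = lift \<eta> \<alpha>" "\<xi> = tree \<eta>" by auto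
  have "(ed (state \<eta> \<alpha>) [], True) \<in> lc \<xi> g"
    using lc_tree_lift[OF \<eta>(1,2)] ed[of "state \<eta> \<alpha>" "[]"] state_ball[OF \<eta>(1,2)] ball_Nil \<eta>
    by (simp add: out_def)
  moreover have "g \<in> \<xi>" using \<eta> lift_tree by simp
  ultimately show "(g, \<xi>) \<in> graph_arrows"
    using \<eta> lift_FG tree_ball_points tree_graph_shift shift_act_ball_points
    by (auto simp: ta_arrows_def shift_dom_def)
qed

text \<open>The lift of \<open>w\<close> has length \<open>2 * length w\<close>. Bounding the
  preimages by this number turns membership into a condition on finitely many words.\<close>

lemma mem_descend_bounded:
  assumes "\<xi> \<in> ball_points"
  shows "w \<in> descend \<xi> \<longleftrightarrow>
    (\<exists>g\<in>{g \<in> FG E1. length g \<le> 2 * length w}. g \<in> \<xi> \<and> even (length g) \<and> proj g = w)"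
proof
  assume w: "w \<in> descend \<xi>"
  have d: "descend \<xi> \<in> \<Omega>" "tree (descend \<xi>) = \<xi>" using descend_ball_points[OF assms] .
  show "\<exists>g\<in>{g \<in> FG E1. length g \<le> 2 * length w}. g \<in> \<xi> \<and> even (length g) \<and> proj g = w"
    using lift_FG[OF d(1) w] length_lift[OF d(1) w] lift_tree[OF w] proj_lift[OF d(1) w] d(2)
    by (intro bexI[of _ "lift (descend \<xi>) w"]) auto
qed (auto simp: descend_def)

section \<open>Continuity in both directions and the groupoid isomorphism\<close>

lemma continuous_descend:
  "continuous_map (ta_top (FG E1) (subtopology set_top graph_shift) (shift_dom graph_shift) shift_act ball_points)
     (ta_top (FG A) (subtopology set_top \<Omega>) (shift_dom \<Omega>) shift_act \<Omega>)
     (\<lambda>p. (proj (fst p), descend (snd p)))"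
proof (rule continuous_map_ta_top)
  show "(\<lambda>p. (proj (fst p), descend (snd p))) (g, \<xi>) \<in> base_arrows" if "(g, \<xi>) \<in> graph_arrows" for g \<xi>
    using that by (auto simp: graph_arrows_iff base_arrows_iff proj_lift descend_tree)
  show "ball_points \<subseteq> graph_shift" by (auto simp: ball_points_def)
  fix g \<xi> and w :: "'a word"
  assume a: "(g, \<xi>) \<in> graph_arrows"
  let ?F = "{h \<in> FG E1. length h \<le> 2 * length w}"
  have "w \<in> descend \<zeta> \<longleftrightarrow> w \<in> descend \<xi>"
    if "(g, \<zeta>) \<in> graph_arrows" "\<forall>v\<in>?F. v \<in> \<zeta> \<longleftrightarrow> v \<in> \<xi>" for \<zeta>
  proof -
    have "\<xi> \<in> ball_points" "\<zeta> \<in> ball_points" using a that by (auto simp: ta_arrows_def)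
    then show ?thesis using that(2) by (auto simp: mem_descend_bounded)
  qed
  then show "\<exists>F. finite F \<and> (\<forall>\<zeta>. (g, \<zeta>) \<in> graph_arrows \<longrightarrow> (\<forall>v\<in>F. v \<in> \<zeta> \<longleftrightarrow> v \<in> \<xi>) \<longrightarrow>
      fst (proj (fst (g, \<zeta>)), descend (snd (g, \<zeta>))) = fst (proj (fst (g, \<xi>)), descend (snd (g, \<xi>))) \<and>
      (w \<in> snd (proj (fst (g, \<zeta>)), descend (snd (g, \<zeta>)))
        \<longleftrightarrow> w \<in> snd (proj (fst (g, \<xi>)), descend (snd (g, \<xi>)))))"
    using finite_FG_bounded[OF finite_E1] by (intro exI[of _ ?F]) auto
qed simp

lemma state_local:
  assumes "\<eta> \<in> \<Omega>" "\<zeta> \<in> \<Omega>" "\<And>w. length w \<le> M \<Longrightarrow> w \<in> \<eta> \<longleftrightarrow> w \<in> \<zeta>" "\<beta> \<in> \<eta>" "N + length \<beta> \<le> M"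
  shows "state \<eta> \<beta> = state \<zeta> \<beta>"
proof -
  have "\<beta> \<in> \<zeta>" using assms by simp
  moreover have "wmult w \<beta> \<in> \<eta> \<longleftrightarrow> wmult w \<beta> \<in> \<zeta>" if "length w \<le> N" for w
    using assms(3)[of "wmult w \<beta>"] length_wmult[of w \<beta>] assms(5) that by linarith
  ultimately show ?thesis using assms by (auto simp: mem_state Omega_Conv)
qed

lemma lift_local:
  assumes "\<eta> \<in> \<Omega>" "\<zeta> \<in> \<Omega>" "\<And>w. length w \<le> M \<Longrightarrow> w \<in> \<eta> \<longleftrightarrow> w \<in> \<zeta>"
  shows "\<beta> \<in> \<eta> \<Longrightarrow> N + length \<beta> \<le> M \<Longrightarrow> lift \<eta> \<beta> = lift \<zeta> \<beta>"
proof (induction \<beta>)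
  case (Cons \<sigma> \<beta>)
  then have "\<beta> \<in> \<eta>" using Omega_convex[OF assms(1)] right_convex_Cons by blast
  then show ?case
    using Cons state_local[OF assms, where \<beta> = "\<sigma> # \<beta>"] state_local[OF assms, where \<beta> = \<beta>] by simp
qed simp

text \<open>A point of the tree lies over a word no longer than itself, so balls around words of
  length at most \<open>length g\<close> decide it. The one-sided form is applied twice, with \<eta>
  and \<zeta> exchanged.\<close>

lemma tree_local:
  assumes "\<eta> \<in> \<Omega>" "\<zeta> \<in> \<Omega>" "\<And>w. length w \<le> M \<Longrightarrow> w \<in> \<eta> \<longleftrightarrow> w \<in> \<zeta>"
    and "g \<in> tree \<eta>" "N + length g \<le> M"
  shows "g \<in> tree \<zeta>"
  using assms(1,4)
proof (cases rule: tree_cases)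
  case (even \<alpha>)
  then have "N + length \<alpha> \<le> M" using assms(5) length_lift[OF assms(1)] by auto
  then show ?thesis using even lift_local[OF assms(1-3)] assms(3) lift_tree[of \<alpha> \<zeta>] by simp
next
  case (odd \<alpha> e)
  then have l: "N + length \<alpha> \<le> M" using assms(5) length_lift[OF assms(1)] by auto
  have "st e = state \<zeta> \<alpha>" "\<alpha> \<in> \<zeta>" "g = cons_red (e, True) (lift \<zeta> \<alpha>)"
    using state_local[OF assms(1-3) odd(1) l] lift_local[OF assms(1-3) odd(1) l] odd assms(3)[of \<alpha>] l
    by (simp_all add: cons_red_reduced)
  then show ?thesis using tree_outI odd(2) by blast
qed

lemma continuous_lift:
  "continuous_map (ta_top (FG A) (subtopology set_top \<Omega>) (shift_dom \<Omega>) shift_act \<Omega>)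
     (ta_top (FG E1) (subtopology set_top graph_shift) (shift_dom graph_shift) shift_act ball_points)
     (\<lambda>p. (lift (snd p) (fst p), tree (snd p)))"
proof (rule continuous_map_ta_top)
  show "(\<lambda>p. (lift (snd p) (fst p), tree (snd p))) (\<alpha>, \<eta>) \<in> graph_arrows" if "(\<alpha>, \<eta>) \<in> base_arrows" for \<alpha> \<eta>
    using that by (auto simp: graph_arrows_iff base_arrows_iff)
  show "ball_points \<subseteq> graph_shift" by (auto simp: ball_points_def)
  fix \<alpha> \<eta> and g :: "'e word"
  assume a: "(\<alpha>, \<eta>) \<in> base_arrows"
  \<comment> \<open>\<open>length \<alpha>\<close> serves the group coordinate
    \<open>lift \<eta> \<alpha>\<close>, \<open>length g\<close> the bit of \<open>g\<close>, and
    \<open>N\<close> is the radius of the balls read on the way.\<close>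
  let ?M = "N + length \<alpha> + length g"
  let ?F = "{w \<in> FG A. length w \<le> ?M}"
  have "lift \<zeta> \<alpha> = lift \<eta> \<alpha> \<and> (g \<in> tree \<zeta> \<longleftrightarrow> g \<in> tree \<eta>)"
    if z: "(\<alpha>, \<zeta>) \<in> base_arrows" "\<forall>v\<in>?F. v \<in> \<zeta> \<longleftrightarrow> v \<in> \<eta>" for \<zeta>
  proof -
    have 1: "\<eta> \<in> \<Omega>" "\<alpha> \<in> \<eta>" "\<zeta> \<in> \<Omega>" "\<alpha> \<in> \<zeta>" using a z(1) by (auto simp: base_arrows_iff)
    then have "\<eta> \<subseteq> FG A" "\<zeta> \<subseteq> FG A" using Omega_Conv by (auto simp: Conv_def)
    then have 2: "\<And>w. length w \<le> ?M \<Longrightarrow> w \<in> \<eta> \<longleftrightarrow> w \<in> \<zeta>" using z(2) by blast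
    then have 3: "\<And>w. length w \<le> ?M \<Longrightarrow> w \<in> \<zeta> \<longleftrightarrow> w \<in> \<eta>" by simp
    show ?thesis
      using lift_local[OF 1(3,1) 3 1(4)] tree_local[OF 1(1,3) 2, where g = g] tree_local[OF 1(3,1) 3, where g = g]
      by auto
  qed
  then show "\<exists>F. finite F \<and> (\<forall>\<zeta>. (\<alpha>, \<zeta>) \<in> base_arrows \<longrightarrow> (\<forall>v\<in>F. v \<in> \<zeta> \<longleftrightarrow> v \<in> \<eta>) \<longrightarrow>
      fst (lift (snd (\<alpha>, \<zeta>)) (fst (\<alpha>, \<zeta>)), tree (snd (\<alpha>, \<zeta>))) =
      fst (lift (snd (\<alpha>, \<eta>)) (fst (\<alpha>, \<eta>)), tree (snd (\<alpha>, \<eta>))) \<and>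
      (g \<in> snd (lift (snd (\<alpha>, \<zeta>)) (fst (\<alpha>, \<zeta>)), tree (snd (\<alpha>, \<zeta>)))
        \<longleftrightarrow> g \<in> snd (lift (snd (\<alpha>, \<eta>)) (fst (\<alpha>, \<eta>)), tree (snd (\<alpha>, \<eta>)))))"
    using finite_FG_bounded[OF finite_A] by (intro exI[of _ ?F]) auto
qed simp

lemma dyn_equiv_graph_shift:
  "dyn_equiv (FG E1) (subtopology set_top graph_shift) (shift_dom graph_shift) shift_act ball_points
     (FG A) (subtopology set_top \<Omega>) (shift_dom \<Omega>) shift_act \<Omega>"
proof -
  let ?\<Phi> = "\<lambda>p. (proj (fst p), descend (snd p))"
  let ?\<Psi> = "\<lambda>p. (lift (snd p) (fst p), tree (snd p))"
  let ?S = "ta_top (FG E1) (subtopology set_top graph_shift) (shift_dom graph_shift) shift_act ball_points"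
  let ?T = "ta_top (FG A) (subtopology set_top \<Omega>) (shift_dom \<Omega>) shift_act \<Omega>"
  have top: "topspace ?S = graph_arrows" "topspace ?T = base_arrows"
    by (auto simp: topspace_ta_top ball_points_def)
  have "?\<Psi> (?\<Phi> p) = p" if "p \<in> graph_arrows" for p
    using that by (cases p) (auto simp: graph_arrows_iff proj_lift descend_tree)
  moreover have "?\<Phi> (?\<Psi> p) = p" if "p \<in> base_arrows" for p
    using that by (cases p) (auto simp: base_arrows_iff proj_lift descend_tree)
  ultimately have "homeomorphic_maps ?S ?T ?\<Phi> ?\<Psi>"
    using continuous_descend continuous_lift unfolding homeomorphic_maps_def top by blast
  then have hom: "homeomorphic_map ?S ?T ?\<Phi>"
    using homeomorphic_map_maps by blast
  have "(ta_composable shift_act p q \<longleftrightarrow> ta_composable shift_act (?\<Phi> p) (?\<Phi> q)) \<and>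
      (ta_composable shift_act p q \<longrightarrow> ?\<Phi> (ta_prod p q) = ta_prod (?\<Phi> p) (?\<Phi> q))"
    if pq: "p \<in> graph_arrows" "q \<in> graph_arrows" for p q
  proof -
    obtain g \<xi> h \<zeta> where p: "p = (g, \<xi>)" and q: "q = (h, \<zeta>)" by (cases p, cases q)
    have 1: "\<xi> \<in> ball_points" "h \<in> \<zeta>" "\<zeta> \<in> graph_shift" "shift_act h \<zeta> \<in> ball_points"
      using pq by (auto simp: p q ta_arrows_def shift_dom_def)
    have "even (length h)"
      using pq(2) length_lift by (auto simp: q graph_arrows_iff)
    then have "descend (shift_act h \<zeta>) = shift_act (proj h) (descend \<zeta>)"
      using descend_shift_act 1 by blast
    \<comment> \<open>A configuration in \<open>ball_points\<close> is recovered from its projection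
      by \<open>tree\<close>, so composability is reflected as well as preserved.\<close>
    moreover have "\<xi> = shift_act h \<zeta> \<longleftrightarrow> descend \<xi> = descend (shift_act h \<zeta>)"
      using descend_ball_points(2) 1 by metis
    ultimately show ?thesis
      by (simp add: p q ta_composable_def ta_prod_def proj_wmult)
  qed
  then show ?thesis unfolding dyn_equiv_def using hom by blast
qed

section \<open>Fullness and clopenness\<close>

lemma is_full_ball_points:
  "is_full (FG E1) graph_shift (shift_dom graph_shift) shift_act ball_points"
  unfolding is_full_def
proof (intro equalityI subsetI)
  fix \<xi>
  assume "\<xi> \<in> {shift_act g x |g x. g \<in> FG E1 \<and> x \<in> ball_points \<and> x \<in> shift_dom graph_shift g}"
  then show "\<xi> \<in> graph_shift"
    using graph_shift_shift_act by (auto simp: shift_dom_def)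
next
  fix \<xi>
  assume \<xi>: "\<xi> \<in> graph_shift"
  have red: "\<And>w. w \<in> \<xi> \<Longrightarrow> reduced w" using \<xi> by (rule graph_shift_reduced)
  have n: "[] \<in> \<xi>" using \<xi> by (simp add: graph_shift_def)
  have "\<exists>g\<in>\<xi>. g \<in> FG E1 \<and> shift_act g \<xi> \<in> ball_points"
  proof (cases "\<exists>e. (e, True) \<in> lc \<xi> []")
    case True
    then show ?thesis
      using shift_act_ball_points[OF \<xi> n] n by (intro bexI[of _ "[]"]) auto
  next
    case False
    \<comment> \<open>The vertex at 1 is now a range; an edge into it, traversed backwards, leads to
      a ball.\<close>
    have "\<exists>e. (e, False) \<in> lc \<xi> []"
    proof (cases rule: lc_cases[OF \<xi> n])
      case (1 B)
      then show ?thesis using False ed[of B "[]"] ball_Nil[of B] by (auto simp: out_def)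
    qed auto
    then obtain e where e: "(e, False) \<in> lc \<xi> []" ..
    then have g: "[(e, False)] \<in> \<xi>" "e \<in> E1" by (auto simp: mem_local_config cons_red_def)
    have "(e, True) \<in> lc \<xi> [(e, False)]"
      using lc_back_out(2)[OF \<xi> n g(2)] by (simp add: cons_red_def)
    then show ?thesis
      using shift_act_ball_points[OF \<xi> g(1)] g by (intro bexI[of _ "[(e, False)]"]) (auto simp: FG_def)
  qed
  then obtain g where g: "g \<in> \<xi>" "g \<in> FG E1" "shift_act g \<xi> \<in> ball_points" by auto
  have rg: "reduced g" using g red by blast
  have m: "w \<in> shift_act g \<xi> \<longleftrightarrow> reduced w \<and> wmult w g \<in> \<xi>" for w
    using mem_shift_act[OF red rg] .
  have "w \<in> shift_act (winv g) (shift_act g \<xi>) \<longleftrightarrow> w \<in> \<xi>" for w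
    using mem_shift_act[of "shift_act g \<xi>" "winv g" w] m rg red
    by (auto simp: reduced_winv reduced_wmult wmult_cancel_right')
  then have "\<xi> = shift_act (winv g) (shift_act g \<xi>)" by blast
  moreover have "winv g \<in> shift_act g \<xi>"
    using m rg n by (simp add: reduced_winv wmult_winv_left)
  ultimately show "\<xi> \<in> {shift_act g x |g x. g \<in> FG E1 \<and> x \<in> ball_points \<and> x \<in> shift_dom graph_shift g}"
    using g FG_winv graph_shift_shift_act[OF \<xi> g(1)] unfolding shift_dom_def by blast
qed

text \<open>Finiteness of \<open>E1\<close> makes both the presence of some outgoing edge at 1 and
  the absence of all of them open conditions.\<close>

lemma ball_points_clopen:
  "openin (subtopology set_top graph_shift) ball_points"
  "closedin (subtopology set_top graph_shift) ball_points"
proof -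
  let ?F = "(\<lambda>e. [(e, True)]) ` E1"
  have "openin set_top (\<Union>e\<in>E1. {\<xi>. [(e, True)] \<in> \<xi>})"
    using openin_set_top_mem(1) by (intro openin_clauses(3)) auto
  moreover have "ball_points = (\<Union>e\<in>E1. {\<xi>. [(e, True)] \<in> \<xi>}) \<inter> graph_shift"
    by (auto simp: ball_points_def)
  ultimately show "openin (subtopology set_top graph_shift) ball_points"
    unfolding openin_subtopology by blast
  have "openin set_top {\<zeta>. \<forall>w\<in>?F. w \<in> \<zeta> \<longleftrightarrow> w \<in> {}}"
    using finite_E1 by (intro openin_set_top_cylinder) simp
  moreover have "graph_shift - ball_points = {\<zeta>. \<forall>w\<in>?F. w \<in> \<zeta> \<longleftrightarrow> w \<in> {}} \<inter> graph_shift"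
    by (auto simp: ball_points_def)
  ultimately have "openin (subtopology set_top graph_shift) (graph_shift - ball_points)"
    unfolding openin_subtopology by blast
  then show "closedin (subtopology set_top graph_shift) ball_points"
    by (auto simp: closedin_def ball_points_def)
qed

lemma kakutani_graph_shift: "shift_kakutani_equiv E1 graph_shift A \<Omega>"
proof -
  have "is_full (FG A) \<Omega> (shift_dom \<Omega>) shift_act \<Omega>"
    unfolding is_full_def
  proof (intro equalityI subsetI)
    fix \<eta>
    assume \<eta>: "\<eta> \<in> \<Omega>"
    then have "\<eta> = shift_act [] \<eta>" using Omega_reduced by (simp add: shift_act_Nil)
    then show "\<eta> \<in> {shift_act g x |g x. g \<in> FG A \<and> x \<in> \<Omega> \<and> x \<in> shift_dom \<Omega> g}"
      using \<eta> Omega_Nil by (fastforce simp: shift_dom_def)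
  qed (auto simp: shift_dom_def Omega_shift)
  moreover have "openin (subtopology set_top \<Omega>) \<Omega>" "closedin (subtopology set_top \<Omega>) \<Omega>"
    using openin_topspace[of "subtopology set_top \<Omega>"] closedin_topspace[of "subtopology set_top \<Omega>"] by simp_all
  ultimately show ?thesis
    unfolding shift_kakutani_equiv_def kakutani_equiv_def
    using ball_points_clopen is_full_ball_points dyn_equiv_graph_shift
    by (intro exI[of _ ball_points] exI[of _ \<Omega>]) simp
qed

section \<open>The ranges and the separation of the graph\<close>

text \<open>The second component is the common part of the balls at the two ends of an edge labelled by a
  letter \<open>a\<close>, recorded as seen from the source end.\<close>

definition key :: "'e \<Rightarrow> 'a option \<times> 'a word set" where
  "key e = (case lt e of [] \<Rightarrow> (None, st e)
     | (a, b) # _ \<Rightarrow> (Some a, {w. reduced w \<and> length w \<le> N \<and> length (wmult w [(a, False)]) \<le> N \<and>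
         (if b then w else wmult w [(a, False)]) \<in> st e}))"

text \<open>An edge with a negative letter sees the overlap from the other end, so its key
  translates the ball first. Equality of keys of opposite edges is then the comparison made by
  \<open>match\<close>.\<close>

lemma key_eq_match:
  assumes "lt e = [\<sigma>]" "lt e' = [letinv \<sigma>]"
  shows "key e = key e' \<longleftrightarrow> match e e'"
proof -
  have *: "key f = key f' \<longleftrightarrow> match f' f" if "lt f = [(a, True)]" "lt f' = [(a, False)]" for f f' a
    using that by (auto simp: key_def match_def set_eq_iff)
  obtain a b where "\<sigma> = (a, b)" by (cases \<sigma>)
  then show ?thesis
    using *[of e a e'] *[of e' a e] assms match_sym by (cases b) auto
qed

text \<open>The first component fixes the letter up to inversion. A dead end has \<open>None\<close>
  and its whole ball as key, so no other edge shares its range.\<close>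

lemma key_eq_cases:
  assumes "e \<in> E1" "e' \<in> E1" "key e = key e'"
  shows "lt e' = lt e \<or> (\<exists>\<sigma>. lt e = [\<sigma>] \<and> lt e' = [letinv \<sigma>])" "lt e = [] \<Longrightarrow> e' = e"
proof -
  have len: "length (lt e) \<le> 1" "length (lt e') \<le> 1" using assms edge by auto
  then show "lt e' = lt e \<or> (\<exists>\<sigma>. lt e = [\<sigma>] \<and> lt e' = [letinv \<sigma>])"
    using assms(3) by (auto simp: key_def split: list.splits)
  show "e' = e" if "lt e = []"
    using that len assms by (intro edge_eqI) (auto simp: key_def split: list.splits)
qed

text \<open>The ball \<open>st e\<close> occurs in some \<eta> of \<Omega>, so the ball across the
  letter can be cut out of the same \<eta>. Hence both orientations are present at the range of a
  letter.\<close>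

lemma match_ex:
  assumes e: "e \<in> E1" "lt e = [\<sigma>]"
  obtains e' where "e' \<in> E1" "match e e'"
proof -
  obtain \<eta> where \<eta>: "\<eta> \<in> \<Omega>" "st e = trunc N \<eta>" using ball_ex edge e by blast
  have n: "[] \<in> \<eta>" using \<eta> Omega_Nil by blast
  have s: "state \<eta> [] = st e"
    using \<eta> Omega_reduced by (simp add: state_def shift_act_Nil)
  then have "[\<sigma>] \<in> state \<eta> []" using edge e by metis
  then have c: "cons_red \<sigma> [] \<in> \<eta>" using letter_state \<eta> n by blast
  have "ed (state \<eta> []) [\<sigma>] = e" using edge[OF e(1)] e s by simp
  then show thesis
    using that match_state[OF \<eta>(1) n c] edge_state'(1)[OF \<eta>(1) n c] by metis
qed

text \<open>The maps \<open>s\<close> and \<open>r\<close> matter only through which edges they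
  identify, so any injective naming of the vertices can be supplied later.\<close>

lemma OmegaEC_graph_shift:
  fixes s r :: "'e \<Rightarrow> 'v" and C :: "'v \<Rightarrow> 'e set set"
  assumes s: "\<And>e e'. e \<in> E1 \<Longrightarrow> e' \<in> E1 \<Longrightarrow> s e = s e' \<longleftrightarrow> st e = st e'"
    and r: "\<And>e e'. e \<in> E1 \<Longrightarrow> e' \<in> E1 \<Longrightarrow> r e = r e' \<longleftrightarrow> key e = key e'"
    and C: "\<And>v. C v = {X. X \<noteq> {} \<and> (\<exists>l. X = {e \<in> E1. r e = v \<and> lt e = l})}"
  shows "OmegaEC (r ` E1) (s ` E1) E1 r s C = graph_shift"
proof -
  have src: "(\<exists>v\<in>s ` E1. L = {(e, True) |e. e \<in> E1 \<and> s e = v}) \<longleftrightarrow> (\<exists>B\<in>\<G>. L = out B)" for L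
  proof
    assume "\<exists>v\<in>s ` E1. L = {(e, True) |e. e \<in> E1 \<and> s e = v}"
    then obtain f where "f \<in> E1" "L = {(e, True) |e. e \<in> E1 \<and> s e = s f}" by blast
    then have "st f \<in> \<G>" "L = out (st f)" using s edge by (auto simp: out_def)
    then show "\<exists>B\<in>\<G>. L = out B" by blast
  next
    assume "\<exists>B\<in>\<G>. L = out B"
    then obtain B where B: "B \<in> \<G>" "L = out B" by blast
    then have f: "ed B [] \<in> E1" "st (ed B []) = B" using ed ball_Nil by auto
    then have "L = {(e, True) |e. e \<in> E1 \<and> s e = s (ed B [])}" using B s by (auto simp: out_def)
    then show "\<exists>v\<in>s ` E1. L = {(e, True) |e. e \<in> E1 \<and> s e = v}" using f by blast
  qed
  have C_Nil: "C (r e) = {{e}}" if e: "e \<in> E1" "lt e = []" for e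
  proof -
    have 1: "f = e" if "f \<in> E1" "r f = r e" for f
      using key_eq_cases(2)[of e f] e that r[of f e] by simp
    show ?thesis
    proof (intro equalityI subsetI)
      fix X
      assume "X \<in> C (r e)"
      then obtain l where "X \<noteq> {}" "X = {f \<in> E1. r f = r e \<and> lt f = l}" unfolding C by blast
      then show "X \<in> {{e}}" using 1 by blast
    next
      fix X
      assume "X \<in> {{e}}"
      then have "X \<noteq> {}" "X = {f \<in> E1. r f = r e \<and> lt f = []}" using 1 e by auto
      then show "X \<in> C (r e)" unfolding C by blast
    qed
  qed
  \<comment> \<open>The two members of \<open>C (r e)\<close> will be the classes of the two
    orientations of the letter.\<close>
  define cls where "cls e = {f \<in> E1. r f = r e \<and> lt f = lt e}" for e
  have mem_cls: "e \<in> cls e" if "e \<in> E1" for e using that by (simp add: cls_def)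
  have C_match: "C (r e) = {cls e, cls e'}" "cls e \<noteq> cls e'"
    if e: "e \<in> E1" "e' \<in> E1" "match e e'" for e e'
  proof -
    obtain \<sigma> where \<sigma>: "lt e = [\<sigma>]" using e by (auto simp: match_def)
    then have \<sigma>': "lt e' = [letinv \<sigma>]" using match_lt e by blast
    have re: "r e' = r e" using key_eq_match[OF \<sigma> \<sigma>'] e r[of e e'] by simp
    have 1: "lt f = lt e \<or> lt f = lt e'" if "f \<in> E1" "r f = r e" for f
      using key_eq_cases(1)[of e f] that e r[of f e] \<sigma> \<sigma>' by auto
    show "C (r e) = {cls e, cls e'}"
    proof (intro equalityI subsetI)
      fix X
      assume "X \<in> C (r e)"
      then obtain l f where "X = {f \<in> E1. r f = r e \<and> lt f = l}" "f \<in> X" unfolding C by blast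
      then show "X \<in> {cls e, cls e'}" using 1[of f] re by (auto simp: cls_def)
    next
      fix X
      assume "X \<in> {cls e, cls e'}"
      then show "X \<in> C (r e)" unfolding C using mem_cls[OF e(1)] mem_cls[OF e(2)] re
        by (auto simp: cls_def)
    qed
    have "e \<notin> cls e'" using \<sigma> \<sigma>' by (simp add: cls_def)
    then show "cls e \<noteq> cls e'" using mem_cls[OF e(1)] by auto
  qed
  have rng: "(\<exists>v\<in>r ` E1. \<exists>c. (\<forall>X\<in>C v. c X \<in> X) \<and> L = {(c X, False) |X. X \<in> C v}) \<longleftrightarrow>
      (\<exists>e\<in>E1. lt e = [] \<and> L = {(e, False)}) \<or>
      (\<exists>e\<in>E1. \<exists>e'\<in>E1. match e e' \<and> L = {(e, False), (e', False)})" (is "?P \<longleftrightarrow> ?Q") for L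
  proof
    assume ?P
    then obtain e c where e: "e \<in> E1" and c: "\<forall>X\<in>C (r e). c X \<in> X"
      and L: "L = {(c X, False) |X. X \<in> C (r e)}" by blast
    show ?Q
    proof (cases "lt e")
      case Nil
      then have "L = {(e, False)}" using C_Nil[OF e] c L by auto
      then show ?thesis using e Nil by blast
    next
      case (Cons \<sigma> u)
      then have \<sigma>: "lt e = [\<sigma>]" using edge[OF e] by simp
      obtain e' where e': "e' \<in> E1" "match e e'" using match_ex[OF e \<sigma>] .
      note m = C_match[OF e e']
      have 1: "c (cls e) \<in> cls e" "c (cls e') \<in> cls e'" using c m by auto
      have 2: "L = {(c (cls e), False), (c (cls e'), False)}" using L m by auto
      have lt: "lt (c (cls e)) = [\<sigma>]" "lt (c (cls e')) = [letinv \<sigma>]"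
        using 1 \<sigma> match_lt[OF e'(2) \<sigma>] by (auto simp: cls_def)
      have "r e = r e'" using key_eq_match[OF \<sigma> match_lt[OF e'(2) \<sigma>]] e e' r by simp
      \<comment> \<open>Any choices from the two classes have the same range and hence the same key,
        so they match: this is the freedom of choice that the separation demands.\<close>
      then have "key (c (cls e)) = key (c (cls e'))"
        using 1 r[of "c (cls e)" "c (cls e')"] by (auto simp: cls_def)
      then have "match (c (cls e)) (c (cls e'))" using key_eq_match[OF lt] by simp
      then show ?thesis using 1 2 by (auto simp: cls_def)
    qed
  next
    assume ?Q
    then consider e where "e \<in> E1" "lt e = []" "L = {(e, False)}"
      | e e' where "e \<in> E1" "e' \<in> E1" "match e e'" "L = {(e, False), (e', False)}" by blast
    then show ?P
    proof cases
      case (1 e)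
      define c where "c X = e" for X :: "'e set"
      have "(\<forall>X\<in>C (r e). c X \<in> X) \<and> L = {(c X, False) |X. X \<in> C (r e)}"
        using C_Nil 1 by (auto simp: c_def)
      then have "\<exists>c. (\<forall>X\<in>C (r e). c X \<in> X) \<and> L = {(c X, False) |X. X \<in> C (r e)}"
        by (intro exI[of _ c])
      then show ?thesis using 1(1) by (rule bexI[OF _ imageI])
    next
      case (2 e e')
      note m = C_match[OF 2(1-3)]
      define c where "c X = (if X = cls e then e else e')" for X
      have "c (cls e) = e" "c (cls e') = e'" using m by (auto simp: c_def)
      then have "\<forall>X\<in>C (r e). c X \<in> X" "L = (\<lambda>X. (c X, False)) ` C (r e)"
        using 2 mem_cls unfolding m(1) by auto
      then have "(\<forall>X\<in>C (r e). c X \<in> X) \<and> L = {(c X, False) |X. X \<in> C (r e)}"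
        by (simp only: Setcompr_eq_image)
      then have "\<exists>c. (\<forall>X\<in>C (r e). c X \<in> X) \<and> L = {(c X, False) |X. X \<in> C (r e)}"
        by (intro exI[of _ c])
      then show ?thesis using 2(1) by (rule bexI[OF _ imageI])
    qed
  qed
  show ?thesis
    unfolding OmegaEC_def graph_shift_def src rng ..
qed

lemma finite_bipartite_sep_graph_ball:
  fixes s r :: "'e \<Rightarrow> 'v" and C :: "'v \<Rightarrow> 'e set set"
  assumes "s ` E1 \<inter> r ` E1 = {}"
    and C: "\<And>v. C v = {X. X \<noteq> {} \<and> (\<exists>l. X = {e \<in> E1. r e = v \<and> lt e = l})}"
  shows "finite_bipartite_sep_graph (r ` E1 \<union> s ` E1) (r ` E1) (s ` E1) E1 r s C"
proof -
  have "\<Union> (C v) = {e \<in> E1. r e = v}" for v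
  proof (intro equalityI subsetI)
    show "e \<in> {e \<in> E1. r e = v}" if "e \<in> \<Union> (C v)" for e
      using that unfolding C by blast
    fix e
    assume "e \<in> {e \<in> E1. r e = v}"
    then have "e \<in> {f \<in> E1. r f = v \<and> lt f = lt e}" by simp
    then show "e \<in> \<Union> (C v)" unfolding C by blast
  qed
  moreover have "X \<inter> Y = {}" if "X \<in> C v" "Y \<in> C v" "X \<noteq> Y" for X Y v
    using that unfolding C by auto
  moreover have "X \<noteq> {}" if "X \<in> C v" for X v
    using that unfolding C by simp
  moreover have "C v = {}" if "v \<notin> r ` E1 \<union> s ` E1" for v
    using that unfolding C by auto
  ultimately show ?thesis
    using assms(1) finite_E1 unfolding finite_bipartite_sep_graph_def by (simp add: Int_commute)
qed

end

section \<open>From forbidden balls to occurring balls, and the encoding by natural numbers\<close>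

lemma of_finite_type_radius:
  assumes "convex_subshift A \<Omega>" "of_finite_type A \<Omega>"
  obtains N where "1 \<le> N" "\<And>\<eta>. \<eta> \<in> \<Omega> \<longleftrightarrow>
    \<eta> \<in> Conv A \<and> (\<forall>\<alpha>\<in>\<eta>. trunc N (shift_act \<alpha> \<eta>) \<in> trunc N ` \<Omega>)"
proof -
  obtain \<F> where F: "finite \<F>" "\<Omega> = {\<xi> \<in> Conv A. \<forall>Bn\<in>\<F>. avoids \<xi> Bn}"
    using assms(2) by (auto simp: of_finite_type_def)
  have sub: "\<Omega> \<subseteq> Conv A" and shift: "\<And>\<alpha> \<xi>. \<alpha> \<in> FG A \<Longrightarrow> \<xi> \<in> \<Omega> \<Longrightarrow> \<alpha> \<in> \<xi> \<Longrightarrow> shift_act \<alpha> \<xi> \<in> \<Omega>"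
    using assms(1) by (auto simp: convex_subshift_def)
  \<comment> \<open>\<open>insert 0\<close> covers an empty family of forbidden balls, and
    \<open>Suc\<close> ensures \<open>1 \<le> N\<close>.\<close>
  define N where "N = Suc (Max (insert 0 (snd ` \<F>)))"
  have N: "snd Bn \<le> N" if "Bn \<in> \<F>" for Bn
    using F(1) that by (auto simp: N_def intro!: le_SucI Max_ge)
  have iff: "\<eta> \<in> \<Omega> \<longleftrightarrow> \<eta> \<in> Conv A \<and> (\<forall>\<alpha>\<in>\<eta>. trunc N (shift_act \<alpha> \<eta>) \<in> trunc N ` \<Omega>)" for \<eta>
  proof
    assume "\<eta> \<in> \<Omega>"
    moreover from this have "\<eta> \<in> Conv A" "\<eta> \<subseteq> FG A" using sub by (auto simp: Conv_def)
    ultimately show "\<eta> \<in> Conv A \<and> (\<forall>\<alpha>\<in>\<eta>. trunc N (shift_act \<alpha> \<eta>) \<in> trunc N ` \<Omega>)"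
      using shift by blast
  next
    assume \<eta>: "\<eta> \<in> Conv A \<and> (\<forall>\<alpha>\<in>\<eta>. trunc N (shift_act \<alpha> \<eta>) \<in> trunc N ` \<Omega>)"
    \<comment> \<open>The \<open>N\<close>-ball of \<eta> around \<open>\<alpha>\<close> is that of
      some \<open>\<zeta>\<close> in \<Omega> around 1. As \<open>N\<close> is at least the radius
      of \<open>Bn\<close>, an occurrence of \<open>Bn\<close> would be visible in
      \<open>\<zeta>\<close> too.\<close>
    have "avoids \<eta> Bn" if Bn: "Bn \<in> \<F>" for Bn
      unfolding avoids_def
    proof
      fix \<alpha>
      assume "\<alpha> \<in> \<eta>"
      then obtain \<zeta> where z: "\<zeta> \<in> \<Omega>" "trunc N (shift_act \<alpha> \<eta>) = trunc N \<zeta>" using \<eta> by auto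
      have tr: "trunc (snd Bn) (trunc N \<xi>) = trunc (snd Bn) \<xi>" for \<xi> :: "'a word set"
        using N[OF Bn] by (auto simp: trunc_def)
      have "trunc (snd Bn) (shift_act \<alpha> \<eta>) = trunc (snd Bn) \<zeta>"
        using tr[of "shift_act \<alpha> \<eta>"] tr[of \<zeta>] z(2) by simp
      moreover have zC: "\<zeta> \<in> Conv A" using z sub by blast
      then have "shift_act [] \<zeta> = \<zeta>" using Conv_reduced by (intro shift_act_Nil) blast
      moreover have "[] \<in> \<zeta>" using zC by (simp add: Conv_def)
      moreover have "avoids \<zeta> Bn" using z F(2) Bn by auto
      ultimately show "trunc (snd Bn) (shift_act \<alpha> \<eta>) \<noteq> fst Bn"
        unfolding avoids_def by metis
    qed
    then show "\<eta> \<in> \<Omega>" using F(2) \<eta> by auto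
  qed
  have "1 \<le> N" by (simp add: N_def)
  then show thesis using iff by (rule that)
qed

theorem theorem3:
  fixes A :: "'a set" and \<Omega> :: "'a word set set"
  assumes "finite A"
    and "convex_subshift A \<Omega>"
    and "of_finite_type A \<Omega>"
  shows "\<exists>(E0 :: nat set) E00 E01 (E1 :: nat set) r s C.
           finite_bipartite_sep_graph E0 E00 E01 E1 r s C \<and>
           shift_kakutani_equiv E1 (OmegaEC E00 E01 E1 r s C) A \<Omega>"
proof -
  obtain N where N: "1 \<le> N" and iff: "\<And>\<eta>. \<eta> \<in> \<Omega> \<longleftrightarrow>
    \<eta> \<in> Conv A \<and> (\<forall>\<alpha>\<in>\<eta>. trunc N (shift_act \<alpha> \<eta>) \<in> trunc N ` \<Omega>)"
    using of_finite_type_radius[OF assms(2,3)] by metis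
  have \<Omega>: "\<Omega> \<subseteq> Conv A" using iff by blast
  let ?W = "{w \<in> FG A. length w \<le> N}"
  have W: "finite ?W" using assms(1) by (rule finite_FG_bounded)
  define P where "P = {(B, w). B \<in> trunc N ` \<Omega> \<and> w \<in> B \<and> length w \<le> 1}"
  have "P \<subseteq> Pow ?W \<times> ?W" using \<Omega> by (auto simp: P_def trunc_def Conv_def)
  moreover have "finite (Pow ?W \<times> ?W)" using W by simp
  ultimately have fP: "finite P" by (rule finite_subset)
  \<comment> \<open>The graph is to live on natural numbers; finiteness of \<open>P\<close> provides
    an encoding of the edges.\<close>
  obtain code :: "'a word set \<times> 'a word \<Rightarrow> nat" where code: "inj_on code P"
    using finite_imp_inj_to_nat_seg[OF fP] by (elim exE conjE) (rule that)
  define dec where "dec = inv_into P code"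
  define E1 where "E1 = code ` P"
  have dec: "dec (code p) = p" if "p \<in> P" for p
    unfolding dec_def using code that by (rule inv_into_f_f)
  interpret ball_graph A \<Omega> N "trunc N ` \<Omega>" E1 "fst \<circ> dec" "snd \<circ> dec" "curry code"
  proof
    show "finite E1" using fP by (simp add: E1_def)
    show "shift_act \<alpha> \<eta> \<in> \<Omega>" if "\<eta> \<in> \<Omega>" "\<alpha> \<in> \<eta>" for \<eta> \<alpha>
      using assms(2) that \<Omega> by (auto simp: convex_subshift_def Conv_def)
    show "curry code B w \<in> E1 \<and> (fst \<circ> dec) (curry code B w) = B \<and> (snd \<circ> dec) (curry code B w) = w"
      if "B \<in> trunc N ` \<Omega>" "w \<in> B" "length w \<le> 1" for B w
      using that dec[of "(B, w)"] by (auto simp: E1_def P_def)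
    show "(fst \<circ> dec) e \<in> trunc N ` \<Omega> \<and> (snd \<circ> dec) e \<in> (fst \<circ> dec) e \<and> length ((snd \<circ> dec) e) \<le> 1 \<and>
        curry code ((fst \<circ> dec) e) ((snd \<circ> dec) e) = e" if e: "e \<in> E1" for e
    proof -
      obtain p where p: "p \<in> P" "e = code p" using e unfolding E1_def by blast
      then show ?thesis using dec[OF p(1)] by (auto simp: P_def)
    qed
    show "\<exists>\<eta>\<in>\<Omega>. B = trunc N \<eta>" if "B \<in> trunc N ` \<Omega>" for B
      using that by auto
  qed (fact assms(1) N iff)+
  \<comment> \<open>The sum type keeps balls and ranges apart, which makes the two vertex sets
    disjoint.\<close>
  define V where "V = Inl ` (fst \<circ> dec) ` E1 \<union> Inr ` key ` E1"
  have fV: "finite V" using finite_E1 by (simp add: V_def)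
  obtain vcode :: "'a word set + 'a option \<times> 'a word set \<Rightarrow> nat" where v: "inj_on vcode V"
    using finite_imp_inj_to_nat_seg[OF fV] by (elim exE conjE) (rule that)
  define s where "s e = vcode (Inl ((fst \<circ> dec) e))" for e
  define r where "r e = vcode (Inr (key e))" for e
  define C where "C v = {X. X \<noteq> {} \<and> (\<exists>l. X = {e \<in> E1. r e = v \<and> (snd \<circ> dec) e = l})}" for v
  have s: "s e = s e' \<longleftrightarrow> (fst \<circ> dec) e = (fst \<circ> dec) e'" if "e \<in> E1" "e' \<in> E1" for e e'
    unfolding s_def using inj_on_eq_iff[OF v, of "Inl ((fst \<circ> dec) e)" "Inl ((fst \<circ> dec) e')"] that
    by (auto simp: V_def)
  have r: "r e = r e' \<longleftrightarrow> key e = key e'" if "e \<in> E1" "e' \<in> E1" for e e'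
    unfolding r_def using inj_on_eq_iff[OF v, of "Inr (key e)" "Inr (key e')"] that
    by (auto simp: V_def)
  have "s e \<noteq> r e'" if "e \<in> E1" "e' \<in> E1" for e e'
    unfolding s_def r_def using inj_on_eq_iff[OF v, of "Inl ((fst \<circ> dec) e)" "Inr (key e')"] that
    by (auto simp: V_def)
  then have "s ` E1 \<inter> r ` E1 = {}" by auto
  then have "finite_bipartite_sep_graph (r ` E1 \<union> s ` E1) (r ` E1) (s ` E1) E1 r s C"
    using C_def by (rule finite_bipartite_sep_graph_ball)
  moreover have "OmegaEC (r ` E1) (s ` E1) E1 r s C = graph_shift"
    using s r C_def by (rule OmegaEC_graph_shift)
  ultimately show ?thesis using kakutani_graph_shift by metis
qed

end
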